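(* Let $\mathcal H$ be an infinite-dimensional complex Hilbert space and let $A$ be an unbounded self-adjoint operator in $\mathcal H$. Then the following assertions are equivalent: (1) there exists a unitary operator $U$ in $\mathcal H$ such that $\mathrm{dom}(U^*AU)\cap\mathrm{dom}\,A=\{0\}$; (2) there exists an unbounded self-adjoint operator $S$ in $\mathcal H$ such that $\mathrm{dom}\,S\cap\mathrm{dom}\,A=\{0\}$; (3) there exists a fundamental symmetry $J$ in $\mathcal H$ (i.e. $J=J^*=J^{-1}$) such that $\mathrm{dom}(JAJ)\cap\mathrm{dom}\,A=\{0\}$; (4) there exists a (closed) subspace $\mathfrak M$ in $\mathcal H$ such that $\mathfrak M\cap\mathrm{dom}\,A=\mathfrak M^\perp\cap\mathrm{dom}\,A=\{0\}$; (5) there exists a positive definite self-adjoint operator $B$ in $\mathcal H$ such that $\mathrm{dom}\,B\supset\mathrm{dom}\,A$ and $\mathrm{clos}\{B\,\mathrm{dom}\,A\}\cap\mathrm{dom}\,B=\{0\}$; (6) there exists a closed densely defined restriction $A_0$ of $A$ such that $\mathrm{dom}(AA_0)=\{0\}$ (this yields, in particular, $\mathrm{dom}\,A_0^2=\{0\}$).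
   Context: $\mathrm{dom}\,T$ is the domain of a linear operator $T$; $\mathrm{dom}(AA_0)=\{f\in\mathrm{dom}\,A_0: A_0f\in\mathrm{dom}\,A\}$. $B\,\mathrm{dom}\,A=\{Bf:f\in\mathrm{dom}\,A\}$ and $\mathrm{clos}$ is norm closure. A (possibly unbounded) self-adjoint operator $B$ is positive definite if $(Bf,f)\ge m\|f\|^2$ for all $f\in\mathrm{dom}\,B$ and some $m>0$. *)

theory Defs
  imports "HOL-Analysis.Analysis"
begin

text \<open>
  Complex inner product spaces, built on top of \<open>real_inner\<close> so that norm and topology are the
  ones of the library. The complex inner product is linear in its first argument; its real part is
  the underlying real inner product, hence \<open>norm x = sqrt (Re (cinner x x))\<close> and \<open>cinner\<close> is
  positive definite.
\<close>

class complex_inner = real_inner +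
  fixes scaleC :: "complex \<Rightarrow> 'a \<Rightarrow> 'a" (infixr \<open>*\<^sub>C\<close> 75)
    and cinner :: "'a \<Rightarrow> 'a \<Rightarrow> complex"
  assumes scaleC_add_right: "a *\<^sub>C (x + y) = a *\<^sub>C x + a *\<^sub>C y"
    and scaleC_add_left: "(a + b) *\<^sub>C x = a *\<^sub>C x + b *\<^sub>C x"
    and scaleC_scaleC: "a *\<^sub>C b *\<^sub>C x = (a * b) *\<^sub>C x"
    and scaleC_of_real: "complex_of_real r *\<^sub>C x = r *\<^sub>R x"
    and cinner_commute: "cinner x y = cnj (cinner y x)"
    and cinner_add_left: "cinner (x + y) z = cinner x z + cinner y z"
    and cinner_scaleC_left: "cinner (a *\<^sub>C x) y = a * cinner x y"
    and Re_cinner: "Re (cinner x y) = inner x y"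

class complex_hilbert = complex_inner + complete_space

global_interpretation complex_vector: vector_space "scaleC :: complex \<Rightarrow> 'a \<Rightarrow> 'a::complex_inner"
  defines csubspace = complex_vector.subspace
    and cspan = complex_vector.span
proof
  fix x :: 'a
  show "1 *\<^sub>C x = x"
    using scaleC_of_real[of 1 x] by simp
qed (rule scaleC_add_right scaleC_add_left scaleC_scaleC)+

definition orthogonal_complement :: "'a::complex_inner set \<Rightarrow> 'a set" where
  "orthogonal_complement M = {x. \<forall>y\<in>M. cinner x y = 0}"

text \<open>
  An operator in \<open>H\<close> with domain possibly smaller than \<open>H\<close> is a partial map \<open>T :: 'a \<rightharpoonup> 'a\<close>:
  its domain is \<open>dom T\<close>, its value at \<open>f \<in> dom T\<close> is \<open>the (T f)\<close>, equality of operators includes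
  equality of domains, \<open>A\<^sub>0 \<subseteq>\<^sub>m A\<close> says that \<open>A\<^sub>0\<close> is a restriction of \<open>A\<close>, \<open>Some\<close> is the identity
  operator, and \<open>S \<circ>\<^sub>m T\<close> is the product \<open>S T\<close> on its natural domain
  \<open>{f \<in> dom T. the (T f) \<in> dom S}\<close>.
\<close>

definition linear_operator :: "('a::complex_inner \<rightharpoonup> 'a) \<Rightarrow> bool" where
  "linear_operator T \<longleftrightarrow>
     csubspace (dom T) \<and>
     (\<forall>f\<in>dom T. \<forall>g\<in>dom T. the (T (f + g)) = the (T f) + the (T g)) \<and>
     (\<forall>c. \<forall>f\<in>dom T. the (T (c *\<^sub>C f)) = c *\<^sub>C the (T f))"

lemma dom_operator_product: "dom (S \<circ>\<^sub>m T) = {f \<in> dom T. the (T f) \<in> dom S}"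
  by (auto simp: map_comp_def split: option.splits)

definition bounded_operator :: "('a::complex_inner \<rightharpoonup> 'a) \<Rightarrow> bool" where
  "bounded_operator T \<longleftrightarrow> (\<exists>K. \<forall>f\<in>dom T. norm (the (T f)) \<le> K * norm f)"

definition densely_defined :: "('a::complex_inner \<rightharpoonup> 'a) \<Rightarrow> bool" where
  "densely_defined T \<longleftrightarrow> closure (dom T) = UNIV"

definition closed_operator :: "('a::complex_inner \<rightharpoonup> 'a) \<Rightarrow> bool" where
  "closed_operator T \<longleftrightarrow> closed (Map.graph T)"

text \<open>
  The adjoint; the vector \<open>h\<close> below is unique when \<open>T\<close> is densely defined, and \<open>adjoint_op T\<close> is
  meaningful only in that case.
\<close>

definition adjoint_op :: "('a::complex_inner \<rightharpoonup> 'a) \<Rightarrow> ('a \<rightharpoonup> 'a)" where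
  "adjoint_op T = (\<lambda>g.
     if \<exists>h. \<forall>f\<in>dom T. cinner (the (T f)) g = cinner f h
     then Some (THE h. \<forall>f\<in>dom T. cinner (the (T f)) g = cinner f h)
     else None)"

definition self_adjoint :: "('a::complex_inner \<rightharpoonup> 'a) \<Rightarrow> bool" where
  "self_adjoint T \<longleftrightarrow> linear_operator T \<and> densely_defined T \<and> adjoint_op T = T"

text \<open>For self-adjoint \<open>B\<close> the number \<open>(B f, f)\<close> is real, so taking \<open>Re\<close> loses nothing.\<close>

definition positive_definite :: "('a::complex_inner \<rightharpoonup> 'a) \<Rightarrow> bool" where
  "positive_definite B \<longleftrightarrow> (\<exists>m>0. \<forall>f\<in>dom B. Re (cinner (the (B f)) f) \<ge> m * (norm f)\<^sup>2)"

definition unitary_operator :: "('a::complex_inner \<rightharpoonup> 'a) \<Rightarrow> bool" where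
  "unitary_operator U \<longleftrightarrow>
     linear_operator U \<and> bounded_operator U \<and> dom U = UNIV \<and>
     adjoint_op U \<circ>\<^sub>m U = Some \<and> U \<circ>\<^sub>m adjoint_op U = Some"

text \<open>\<open>J = J\<^sup>* = J\<^sup>-\<^sup>1\<close>, with \<open>J = J\<^sup>-\<^sup>1\<close> written as \<open>J J = I\<close>.\<close>

definition fundamental_symmetry :: "('a::complex_inner \<rightharpoonup> 'a) \<Rightarrow> bool" where
  "fundamental_symmetry J \<longleftrightarrow>
     linear_operator J \<and> bounded_operator J \<and> dom J = UNIV \<and>
     adjoint_op J = J \<and> J \<circ>\<^sub>m J = Some"

definition all_equivalent :: "bool list \<Rightarrow> bool" where
  "all_equivalent Ps \<longleftrightarrow> (\<forall>P\<in>set Ps. \<forall>Q\<in>set Ps. P \<longleftrightarrow> Q)"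

end

theory Submission
  imports Defs
begin

text \<open>
  For a self-adjoint \<open>A\<close> the resolvents \<open>T = (A + \<i>)\<^sup>-\<^sup>1\<close> and \<open>T\<^sup>* = (A - \<i>)\<^sup>-\<^sup>1\<close> are bounded with range
  \<open>dom A\<close>. Closed restrictions of \<open>A\<close> correspond to closed subspaces \<open>M = (A + \<i>) dom A\<^sub>0\<close>; under this
  correspondence \<open>dom (A A\<^sub>0) = {0}\<close> means \<open>M \<inter> dom A = {0}\<close>, and density of \<open>dom A\<^sub>0\<close> means
  \<open>M\<^sup>\<bottom> \<inter> dom A = {0}\<close>, which gives (4) \<open>\<longleftrightarrow>\<close> (6). The remaining implications form the cycle
  (1) \<open>\<longrightarrow>\<close> (2) \<open>\<longrightarrow>\<close> (5) \<open>\<longrightarrow>\<close> (4) \<open>\<longrightarrow>\<close> (3) \<open>\<longrightarrow>\<close> (1), with \<open>S = U\<^sup>* A U\<close>,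
  \<open>M = clos (B dom A)\<close> and \<open>J = 2 P\<^sub>M - 1\<close>. The step (2) \<open>\<longrightarrow>\<close> (5) takes
  \<open>B = (T T\<^sup>* + C C\<^sup>*)\<^sup>-\<^sup>1\<^sup>/\<^sup>2\<close> with \<open>C = (S + \<i>)\<^sup>-\<^sup>1\<close>.
\<close>

text \<open>Through this sort the bounded operators on the space form a complete space, which the
  norm limit of the square root iteration needs.\<close>

instance complex_hilbert \<subseteq> banach ..

section \<open>Complex scalars and the real inner product\<close>

text \<open>As \<open>Re (\<i> * z) = - Im z\<close>, the complex product is recovered from its real
  part. Arguments can then run on \<open>inner\<close> whenever the vectors tested form a set closed
  under multiplication by \<open>\<i>\<close>.\<close>

lemma cinner_conv_inner: "cinner x y = Complex (inner x y) (- inner (\<i> *\<^sub>C x) y)"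
  by (simp add: complex_eq_iff flip: Re_cinner add: cinner_scaleC_left)

lemma Im_cinner: "Im (cinner x y) = inner x (\<i> *\<^sub>C y)"
proof -
  have "Im (cinner x y) = - Im (cinner y x)"
    by (metis cinner_commute cnj.sel(2))
  also have "\<dots> = inner x (\<i> *\<^sub>C y)"
    unfolding cinner_conv_inner by (simp add: inner_commute)
  finally show ?thesis .
qed

lemma cinner_scaleC_right: "cinner x (c *\<^sub>C y) = cnj c * cinner x y"
  by (metis cinner_commute cinner_scaleC_left complex_cnj_mult complex_cnj_cnj)

lemma norm_scaleC: "norm (c *\<^sub>C x) = cmod c * norm (x :: 'a :: complex_inner)"
proof -
  have "(norm (c *\<^sub>C x))\<^sup>2 = Re ((c * cnj c) * cinner x x)"
    unfolding power2_norm_eq_inner Re_cinner[symmetric] cinner_scaleC_left cinner_scaleC_right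
    by (simp only: mult_ac)
  also have "\<dots> = (cmod c * norm x)\<^sup>2"
    unfolding complex_norm_square[symmetric]
    by (simp add: Re_cinner power_mult_distrib power2_norm_eq_inner)
  finally show ?thesis
    by (simp add: power2_eq_iff_nonneg)
qed

lemma bounded_linear_scaleC: "bounded_linear ((*\<^sub>C) c :: 'a :: complex_inner \<Rightarrow> 'a)"
proof (rule bounded_linear_intro[where K = "cmod c"])
  show "c *\<^sub>C (r *\<^sub>R x) = r *\<^sub>R (c *\<^sub>C x)" for r and x :: 'a
    by (simp add: scaleC_scaleC mult.commute flip: scaleC_of_real)
qed (simp_all add: scaleC_add_right norm_scaleC mult.commute)

lemma csubspace_imp_subspace: "csubspace M \<Longrightarrow> subspace M"
  unfolding complex_vector.subspace_def subspace_def by (metis scaleC_of_real)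

lemma subspace_closure:
  fixes M :: "'a :: real_normed_vector set"
  assumes "subspace M"
  shows "subspace (closure M)"
proof (rule subspaceI)
  show "0 \<in> closure M"
    using subspace_0[OF assms] closure_subset by blast
  show "x + y \<in> closure M" if "x \<in> closure M" "y \<in> closure M" for x y
  proof -
    obtain f g where "\<forall>n. f n \<in> M" "f \<longlonglongrightarrow> x" "\<forall>n. g n \<in> M" "g \<longlonglongrightarrow> y"
      using \<open>x \<in> closure M\<close> \<open>y \<in> closure M\<close> unfolding closure_sequential by blast
    then show ?thesis
      unfolding closure_sequential using subspace_add[OF assms] tendsto_add[of f x _ g y]
      by (intro exI[of _ "\<lambda>n. f n + g n"]) auto
  qed
  show "c *\<^sub>R x \<in> closure M" if "x \<in> closure M" for c x
  proof -
    obtain f where "\<forall>n. f n \<in> M" "f \<longlonglongrightarrow> x"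
      using \<open>x \<in> closure M\<close> unfolding closure_sequential by blast
    then show ?thesis
      unfolding closure_sequential using subspace_scale[OF assms]
      by (intro exI[of _ "\<lambda>n. c *\<^sub>R f n"]) (auto intro: tendsto_intros)
  qed
qed

lemma csubspace_closure:
  assumes "csubspace M"
  shows "csubspace (closure M)"
proof -
  have "subspace (closure M)"
    using assms by (intro subspace_closure csubspace_imp_subspace)
  moreover have "c *\<^sub>C x \<in> closure M" if "x \<in> closure M" for c x
  proof -
    have "(*\<^sub>C) c ` closure M \<subseteq> closure ((*\<^sub>C) c ` M)"
      by (intro closure_bounded_linear_image_subset bounded_linear_scaleC)
    also have "\<dots> \<subseteq> closure M"
      using assms by (intro closure_mono) (auto simp: complex_vector.subspace_def)
    finally show ?thesis
      using that by blast
  qed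
  ultimately show ?thesis
    by (simp add: complex_vector.subspace_def subspace_def)
qed

text \<open>With \<open>y\<close> also \<open>\<i> *\<^sub>C y\<close> is in \<open>M\<close>, and
  the real product with it is the imaginary part of \<open>cinner x y\<close>.\<close>

lemma orthogonal_complement_csubspace:
  assumes "csubspace M"
  shows "orthogonal_complement M = {x. \<forall>y\<in>M. inner x y = 0}"
proof -
  have "cinner x y = 0" if "\<forall>y\<in>M. inner x y = 0" "y \<in> M" for x y
    using that complex_vector.subspace_scale[OF assms]
    by (simp add: complex_eq_iff Im_cinner Re_cinner)
  moreover have "inner x y = 0" if "cinner x y = 0" for x y :: 'a
    using that by (simp flip: Re_cinner)
  ultimately show ?thesis
    unfolding orthogonal_complement_def by blast
qed

section \<open>Orthogonal projection and density in real Hilbert spaces\<close>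

text \<open>A sequence in \<open>M\<close> whose distances to \<open>x\<close> tend to the infimum
  is Cauchy by the parallelogram law. Its limit attains the infimum, and moving from it along any
  \<open>y\<close> in \<open>M\<close> cannot shorten the distance, which forces
  orthogonality.\<close>

lemma ex_orthogonal_projection:
  fixes M :: "'a :: {real_inner, complete_space} set"
  assumes M: "subspace M" "closed M"
  shows "\<exists>p\<in>M. \<forall>y\<in>M. inner (x - p) y = 0"
proof -
  define d where "d = infdist x M"
  have ne: "M \<noteq> {}"
    using subspace_0[OF M(1)] by blast
  have d_le: "d \<le> norm (x - y)" if "y \<in> M" for y
    using infdist_le[OF that, of x] by (simp add: d_def dist_norm)
  have "d \<ge> 0"
    by (simp add: d_def infdist_nonneg)
  have "\<exists>y\<in>M. dist x y < d + inverse (Suc n)" for n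
    using cINF_less_iff[OF ne, of "dist x" "d + inverse (Suc n)"] ne
    by (auto simp: d_def infdist_notempty intro!: bdd_belowI[of _ 0])
  then obtain p where p: "\<And>n. p n \<in> M" "\<And>n. norm (x - p n) < d + inverse (Suc n)"
    unfolding dist_norm by metis
  have lim: "(\<lambda>n. norm (x - p n)) \<longlonglongrightarrow> d"
  proof (rule tendsto_sandwich[of "\<lambda>_. d" _ _ "\<lambda>n. d + inverse (real (Suc n))"])
    show "(\<lambda>n. d + inverse (real (Suc n))) \<longlonglongrightarrow> d"
      using tendsto_add[OF tendsto_const LIMSEQ_inverse_real_of_nat, of d] by simp
    show "\<forall>\<^sub>F n in sequentially. d \<le> norm (x - p n)"
      using p(1) d_le by simp
    show "\<forall>\<^sub>F n in sequentially. norm (x - p n) \<le> d + inverse (real (Suc n))"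
      using p(2) by (intro always_eventually allI less_imp_le)
  qed simp
  \<comment> \<open>The midpoint of \<open>p m\<close> and \<open>p n\<close> is in
    \<open>M\<close>, hence at distance at least \<open>d\<close> from \<open>x\<close>; the rest is
    the parallelogram identity.\<close>
  have parallelogram: "(norm (p m - p n))\<^sup>2 \<le> 2 * (norm (x - p m))\<^sup>2 + 2 * (norm (x - p n))\<^sup>2 - 4 * d\<^sup>2"
    for m n
  proof -
    have "d \<le> norm (x - (1/2) *\<^sub>R (p m + p n))"
      using M(1) p by (intro d_le) (auto intro!: subspace_scale subspace_add)
    then have "d\<^sup>2 \<le> (norm (x - (1/2) *\<^sub>R (p m + p n)))\<^sup>2"
      using \<open>d \<ge> 0\<close> by (rule power_mono)
    then show ?thesis
      unfolding power2_norm_eq_inner by (simp add: algebra_simps inner_commute)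
  qed
  have "Cauchy p"
    unfolding Cauchy_iff
  proof (intro allI impI)
    fix e :: real assume "e > 0"
    have "(\<lambda>n. 2 * (norm (x - p n))\<^sup>2 - 2 * d\<^sup>2) \<longlonglongrightarrow> 2 * d\<^sup>2 - 2 * d\<^sup>2"
      by (intro tendsto_intros lim)
    then have "eventually (\<lambda>n. 2 * (norm (x - p n))\<^sup>2 - 2 * d\<^sup>2 < e\<^sup>2 / 2) sequentially"
      using \<open>e > 0\<close> by (intro order_tendstoD) auto
    then obtain N where N: "2 * (norm (x - p n))\<^sup>2 - 2 * d\<^sup>2 < e\<^sup>2 / 2" if "n \<ge> N" for n
      unfolding eventually_sequentially by blast
    have "norm (p m - p n) < e" if "m \<ge> N" "n \<ge> N" for m n
    proof -
      have "(norm (p m - p n))\<^sup>2 < e\<^sup>2"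
        using parallelogram[of m n] N[OF that(1)] N[OF that(2)] by argo
      then show ?thesis
        using \<open>e > 0\<close> by (simp add: power2_less_imp_less)
    qed
    then show "\<exists>N. \<forall>m\<ge>N. \<forall>n\<ge>N. norm (p m - p n) < e"
      by blast
  qed
  then obtain q where q: "p \<longlonglongrightarrow> q"
    using Cauchy_convergent convergent_def by blast
  have "q \<in> M"
    using M(2) p(1) q closed_sequentially by blast
  have "norm (x - q) = d"
    by (rule LIMSEQ_unique[OF _ lim]) (intro tendsto_intros q)
  have "inner (x - q) y = 0" if "y \<in> M" for y
  proof (rule ccontr)
    assume neq: "inner (x - q) y \<noteq> 0"
    then have pos: "inner y y > 0"
      by auto
    \<comment> \<open>This \<open>t\<close> minimises the norm of
      \<open>(x - q) - t *\<^sub>R y\<close>, so a nonzero product would push the distance below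
      \<open>d\<close>.\<close>
    define t where "t = inner (x - q) y / inner y y"
    have "d \<le> norm (x - (q + t *\<^sub>R y))"
      using \<open>q \<in> M\<close> that M(1) by (intro d_le) (auto intro!: subspace_scale subspace_add)
    then have "(norm (x - q))\<^sup>2 \<le> (norm ((x - q) - t *\<^sub>R y))\<^sup>2"
      using \<open>d \<ge> 0\<close> unfolding \<open>norm (x - q) = d\<close> by (intro power_mono) (auto simp: algebra_simps)
    also have "\<dots> = (norm (x - q))\<^sup>2 - 2 * t * inner (x - q) y + t\<^sup>2 * inner y y"
      unfolding power2_norm_eq_inner
      by (simp only: inner_diff_left inner_diff_right inner_scaleR_left inner_scaleR_right)
        (simp add: algebra_simps inner_commute power2_eq_square)
    also have "\<dots> = (norm (x - q))\<^sup>2 - (inner (x - q) y)\<^sup>2 / inner y y"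
      using pos by (simp add: t_def field_simps power2_eq_square)
    finally show False
      using pos neq by (simp add: divide_le_0_iff)
  qed
  then show ?thesis
    using \<open>q \<in> M\<close> by blast
qed

text \<open>What remains of \<open>x\<close> after projecting onto the closure is orthogonal to
  \<open>M\<close>, hence zero. The statement is about real spaces so that it also covers the
  product \<open>'a \<times> 'a\<close>.\<close>

lemma closure_subspace_eq_UNIV:
  fixes M :: "'a :: {real_inner, complete_space} set"
  assumes "subspace M" and orth: "\<And>x. (\<And>y. y \<in> M \<Longrightarrow> inner x y = 0) \<Longrightarrow> x = 0"
  shows "closure M = UNIV"
proof -
  have "x \<in> closure M" for x
  proof -
    obtain p where p: "p \<in> closure M" "\<forall>y\<in>closure M. inner (x - p) y = 0"
      using ex_orthogonal_projection[OF subspace_closure[OF assms(1)] closed_closure] by blast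
    then have "x - p = 0"
      using closure_subset by (intro orth) blast
    then show ?thesis
      using p(1) by simp
  qed
  then show ?thesis
    by blast
qed

lemma orthogonal_to_dense:
  assumes "closure M = UNIV" "\<And>y. y \<in> M \<Longrightarrow> inner x y = 0"
  shows "x = 0"
proof -
  have "closed {y. inner x y = 0}"
    by (intro closed_Collect_eq continuous_intros)
  then have "closure M \<subseteq> {y. inner x y = 0}"
    using assms(2) by (intro closure_minimal) auto
  then have "inner x x = 0"
    using assms(1) by blast
  then show ?thesis
    by simp
qed

section \<open>Self-adjoint operators as partial maps\<close>

lemma linear_operatorD:
  assumes "linear_operator T"
  shows "csubspace (dom T)" "0 \<in> dom T"
    "f \<in> dom T \<Longrightarrow> g \<in> dom T \<Longrightarrow> f + g \<in> dom T"
    "f \<in> dom T \<Longrightarrow> g \<in> dom T \<Longrightarrow> f - g \<in> dom T"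
    "f \<in> dom T \<Longrightarrow> c *\<^sub>C f \<in> dom T"
    "f \<in> dom T \<Longrightarrow> g \<in> dom T \<Longrightarrow> the (T (f + g)) = the (T f) + the (T g)"
    "f \<in> dom T \<Longrightarrow> the (T (c *\<^sub>C f)) = c *\<^sub>C the (T f)"
  using assms complex_vector.subspace_0[of "dom T"] complex_vector.subspace_add[of "dom T"]
    complex_vector.subspace_diff[of "dom T"] complex_vector.subspace_scale[of "dom T"]
  unfolding linear_operator_def by simp_all

text \<open>The domain contains \<open>\<i> *\<^sub>C f\<close> along with \<open>f\<close>, and the
  real identity at both vectors gives the complex one.\<close>

lemma cinner_adjoint_iff_inner:
  assumes "linear_operator T"
  shows "(\<forall>f\<in>dom T. cinner (the (T f)) g = cinner f h) \<longleftrightarrow>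
    (\<forall>f\<in>dom T. inner (the (T f)) g = inner f h)"
proof -
  have "cinner (the (T f)) g = cinner f h"
    if *: "\<forall>f\<in>dom T. inner (the (T f)) g = inner f h" and "f \<in> dom T" for f
  proof -
    have "inner (\<i> *\<^sub>C the (T f)) g = inner (\<i> *\<^sub>C f) h"
      using * linear_operatorD(5,7)[OF assms \<open>f \<in> dom T\<close>] by metis
    then show ?thesis
      using that by (simp add: cinner_conv_inner)
  qed
  then show ?thesis
    by (metis Re_cinner)
qed

text \<open>Density makes the vector in the definite description unique, since the difference of two
  candidates is orthogonal to the domain. The adjoint becomes a relation between \<open>g\<close>
  and \<open>h\<close>, free of \<open>THE\<close>.\<close>

lemma adjoint_op_eq_Some_iff:
  assumes T: "linear_operator T" "closure (dom T) = UNIV"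
  shows "adjoint_op T g = Some h \<longleftrightarrow> (\<forall>f\<in>dom T. inner (the (T f)) g = inner f h)"
proof -
  have uniq: "h1 = h2" if "\<forall>f\<in>dom T. inner (the (T f)) g = inner f h1"
    "\<forall>f\<in>dom T. inner (the (T f)) g = inner f h2" for h1 h2
  proof -
    have "h1 - h2 = 0"
      using that by (intro orthogonal_to_dense[OF T(2)])
        (metis eq_iff_diff_eq_0 inner_commute inner_diff_right)
    then show ?thesis
      by simp
  qed
  define P where "P h \<longleftrightarrow> (\<forall>f\<in>dom T. inner (the (T f)) g = inner f h)" for h
  have "adjoint_op T g = (if \<exists>h. P h then Some (THE h. P h) else None)"
    unfolding adjoint_op_def cinner_adjoint_iff_inner[OF T(1)] P_def ..
  moreover have "(THE h. P h) = h" if "P h" for h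
    using that uniq unfolding P_def[symmetric] by blast
  ultimately show ?thesis
    unfolding P_def[symmetric] by (metis option.distinct(1) option.inject)
qed

lemma self_adjoint_iff:
  "self_adjoint T \<longleftrightarrow> linear_operator T \<and> closure (dom T) = UNIV \<and>
     (\<forall>g h. T g = Some h \<longleftrightarrow> (\<forall>f\<in>dom T. inner (the (T f)) g = inner f h))"
  (is "_ \<longleftrightarrow> ?L \<and> ?D \<and> ?A")
proof -
  have "adjoint_op T = T \<longleftrightarrow> ?A" if "?L" "?D"
  proof -
    have "adjoint_op T = T \<longleftrightarrow> (\<forall>g h. adjoint_op T g = Some h \<longleftrightarrow> T g = Some h)"
      by (auto simp: fun_eq_iff) (metis option.exhaust)
    then show ?thesis
      unfolding adjoint_op_eq_Some_iff[OF that] by blast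
  qed
  then show ?thesis
    by (auto simp: self_adjoint_def densely_defined_def)
qed

lemma self_adjointD:
  assumes "self_adjoint T"
  shows "linear_operator T" "closure (dom T) = UNIV"
    "T g = Some h \<longleftrightarrow> (\<forall>f\<in>dom T. inner (the (T f)) g = inner f h)"
  using assms unfolding self_adjoint_iff by simp_all

lemma self_adjoint_symmetric:
  assumes "self_adjoint T" "f \<in> dom T" "g \<in> dom T"
  shows "inner (the (T f)) g = inner f (the (T g))"
proof -
  have "T g = Some (the (T g))"
    using assms(3) by auto
  then show ?thesis
    using self_adjointD(3)[OF assms(1)] assms(2) by blast
qed

text \<open>The relation defining the adjoint survives limits, so a self-adjoint operator has a
  closed graph.\<close>

lemma self_adjoint_closed:
  assumes T: "self_adjoint T" and f: "\<And>n. f n \<in> dom T" "f \<longlonglongrightarrow> x"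
    and y: "(\<lambda>n. the (T (f n))) \<longlonglongrightarrow> y"
  shows "T x = Some y"
  unfolding self_adjointD(3)[OF T]
proof
  fix e assume e: "e \<in> dom T"
  have "(\<lambda>n. inner (the (T e)) (f n)) \<longlonglongrightarrow> inner (the (T e)) x"
    by (intro tendsto_intros f)
  moreover have "(\<lambda>n. inner (the (T e)) (f n)) \<longlonglongrightarrow> inner e y"
    unfolding self_adjoint_symmetric[OF T e f(1)] by (intro tendsto_intros y)
  ultimately show "inner (the (T e)) x = inner e y"
    by (rule LIMSEQ_unique)
qed

section \<open>Resolvents at the imaginary units\<close>

lemma inner_scaleC_left: "inner (c *\<^sub>C x) y = inner x (cnj c *\<^sub>C y)"
  unfolding Re_cinner[symmetric] cinner_scaleC_left cinner_scaleC_right by simp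

lemma scaleC_zero [simp]: "c *\<^sub>C 0 = 0" "0 *\<^sub>C x = 0"
  by (simp_all add: complex_vector.scale_zero_left complex_vector.scale_zero_right)

lemma scaleC_minus_left: "(- c) *\<^sub>C x = - (c *\<^sub>C x)"
  by (rule complex_vector.scale_minus_left)

lemma scaleC_diff_right: "c *\<^sub>C (x - y) = c *\<^sub>C x - c *\<^sub>C y"
  by (rule complex_vector.scale_right_diff_distrib)

text \<open>The hypotheses on \<open>c\<close> single out \<open>\<i>\<close> and
  \<open>- \<i>\<close>. Symmetry of \<open>A\<close> and skewness of \<open>c\<close> make the
  cross term equal to its own negative, which leaves Pythagoras.\<close>

lemma norm_self_adjoint_shift:
  assumes A: "self_adjoint A" and c: "cnj c = - c" "cmod c = 1" and f: "f \<in> dom A"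
  shows "(norm (the (A f) + c *\<^sub>C f))\<^sup>2 = (norm (the (A f)))\<^sup>2 + (norm f)\<^sup>2"
proof -
  have "inner (the (A f)) (c *\<^sub>C f) = inner f (c *\<^sub>C the (A f))"
    using self_adjoint_symmetric[OF A f] linear_operatorD(5,7)[OF self_adjointD(1)[OF A] f]
    by metis
  also have "\<dots> = - inner (the (A f)) (c *\<^sub>C f)"
    using inner_scaleC_left[of c "the (A f)" f] c(1)
      inner_scaleC_left[of c f "the (A f)"]
    by (simp add: inner_commute scaleC_minus_left)
  finally have "inner (the (A f)) (c *\<^sub>C f) = 0"
    by simp
  then show ?thesis
    using c(2) by (simp add: norm_add_Pythagorean orthogonal_def norm_scaleC)
qed

text \<open>The inverse of \<open>A + c\<close>, that is, the usual resolvent at \<open>- c\<close>.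
  It is a total function because for self-adjoint \<open>A\<close> and \<open>c\<close> equal to
  \<open>\<i>\<close> or \<open>- \<i>\<close> the shift maps \<open>dom A\<close> bijectively onto
  the space.\<close>

definition resolvent :: "('a::complex_inner \<rightharpoonup> 'a) \<Rightarrow> complex \<Rightarrow> 'a \<Rightarrow> 'a" where
  "resolvent A c y = (THE f. f \<in> dom A \<and> the (A f) + c *\<^sub>C f = y)"

lemma self_adjoint_shift_inj:
  assumes A: "self_adjoint A" and c: "cnj c = - c" "cmod c = 1"
    and f: "f \<in> dom A" "g \<in> dom A" "the (A f) + c *\<^sub>C f = the (A g) + c *\<^sub>C g"
  shows "f = g"
proof -
  note L = linear_operatorD[OF self_adjointD(1)[OF A]]
  have "the (A ((f - g) + g)) = the (A (f - g)) + the (A g)"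
    using f by (intro L)
  then have "the (A (f - g)) + c *\<^sub>C (f - g) = 0"
    using f(3) by (simp add: scaleC_diff_right algebra_simps)
  then show ?thesis
    using norm_self_adjoint_shift[OF A c L(4)[OF f(1,2)]]
    by (simp add: add_nonneg_eq_0_iff)
qed

text \<open>The shift does not decrease norms and \<open>A\<close> is closed, so its range is
  closed. A vector orthogonal to the range satisfies \<open>A x = c x\<close>, and the norm identity
  for \<open>- c\<close> makes it zero, so the range is also dense.\<close>

lemma self_adjoint_shift_surj:
  fixes A :: "'a::complex_hilbert \<rightharpoonup> 'a"
  assumes A: "self_adjoint A" and c: "cnj c = - c" "cmod c = 1"
  shows "\<exists>f\<in>dom A. the (A f) + c *\<^sub>C f = y"
proof -
  note L = linear_operatorD[OF self_adjointD(1)[OF A]]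
  define B where "B f = the (A f) + c *\<^sub>C f" for f
  have add: "B (f + g) = B f + B g" if "f \<in> dom A" "g \<in> dom A" for f g
    using that by (simp add: B_def L(6) scaleC_add_right)
  have scale: "B (a *\<^sub>C f) = a *\<^sub>C B f" if "f \<in> dom A" for a f
    using that by (simp add: B_def L(7) scaleC_add_right scaleC_scaleC mult.commute)
  have diff: "B (f - g) = B f - B g" if "f \<in> dom A" "g \<in> dom A" for f g
    using add[OF L(4)[OF that] that(2)] by simp
  have norm: "norm f \<le> norm (B f)" "norm (the (A f)) \<le> norm (B f)" if "f \<in> dom A" for f
    by (rule power2_le_imp_le; simp add: B_def norm_self_adjoint_shift[OF A c that])+
  have "csubspace (B ` dom A)"
    unfolding complex_vector.subspace_def
  proof (intro conjI ballI allI)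
    show "0 \<in> B ` dom A"
      using L(2) scale[OF L(2), of 0] by (metis imageI scaleC_zero)
    show "x + y \<in> B ` dom A" if "x \<in> B ` dom A" "y \<in> B ` dom A" for x y
      using that add L(3) by (metis (no_types, lifting) imageE imageI)
    show "a *\<^sub>C x \<in> B ` dom A" if "x \<in> B ` dom A" for a x
      using that scale L(5) by (metis (no_types, lifting) imageE imageI)
  qed
  then have sub: "subspace (B ` dom A)"
    by (rule csubspace_imp_subspace)
  have "closed (B ` dom A)"
    unfolding closed_sequential_limits
  proof safe
    fix y z assume "\<forall>n. y n \<in> B ` dom A" and lim: "y \<longlonglongrightarrow> z"
    then obtain f where f: "\<And>n. f n \<in> dom A" "\<And>n. y n = B (f n)"
      unfolding image_iff by metis
    have "Cauchy y"
      using lim by (rule LIMSEQ_imp_Cauchy)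
    have le: "norm (f m - f n) \<le> norm (y m - y n)" for m n
      using norm(1)[OF L(4)[OF f(1) f(1)]] by (simp add: f(2) diff f(1))
    have "Cauchy f"
      using \<open>Cauchy y\<close> le unfolding Cauchy_iff by (meson le_less_trans)
    then obtain x where x: "f \<longlonglongrightarrow> x"
      using Cauchy_convergent convergent_def by blast
    have "(\<lambda>n. y n - c *\<^sub>C f n) \<longlonglongrightarrow> z - c *\<^sub>C x"
      by (intro tendsto_diff lim bounded_linear.tendsto[OF bounded_linear_scaleC] x)
    then have "(\<lambda>n. the (A (f n))) \<longlonglongrightarrow> z - c *\<^sub>C x"
      by (simp add: f(2) B_def)
    then have "A x = Some (z - c *\<^sub>C x)"
      by (intro self_adjoint_closed[OF A f(1) x])
    then have "x \<in> dom A" "B x = z"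
      by (auto simp: B_def)
    then show "z \<in> B ` dom A"
      by blast
  qed
  moreover have "closure (B ` dom A) = UNIV"
  proof (rule closure_subspace_eq_UNIV[OF sub])
    fix x assume x: "\<And>y. y \<in> B ` dom A \<Longrightarrow> inner x y = 0"
    \<comment> \<open>Moving \<open>c\<close> across turns orthogonality to the range into the
      adjoint relation, which also places \<open>x\<close> in \<open>dom A\<close>.\<close>
    have "A x = Some (c *\<^sub>C x)"
      unfolding self_adjointD(3)[OF A]
    proof
      fix f assume "f \<in> dom A"
      then have "inner (B f) x = 0"
        using x[of "B f"] by (simp add: inner_commute)
      moreover have "inner (B f) x = inner (the (A f)) x - inner f (c *\<^sub>C x)"
        unfolding B_def inner_add_left inner_scaleC_left[of c] c(1)
        by (simp add: scaleC_minus_left)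
      ultimately show "inner (the (A f)) x = inner f (c *\<^sub>C x)"
        by simp
    qed
    moreover have "cnj (- c) = - (- c)" "cmod (- c) = 1"
      using c by simp_all
    ultimately show "x = 0"
      using norm_self_adjoint_shift[OF A, of "- c" x]
      by (auto simp: scaleC_minus_left add_nonneg_eq_0_iff dom_def)
  qed
  ultimately have "y \<in> B ` dom A"
    by (simp add: closure_closed)
  then show ?thesis
    by (auto simp: B_def)
qed

lemma resolvent:
  fixes A :: "'a::complex_hilbert \<rightharpoonup> 'a"
  assumes A: "self_adjoint A" and c: "cnj c = - c" "cmod c = 1"
  shows resolvent_in_dom: "resolvent A c y \<in> dom A"
    and shift_resolvent: "the (A (resolvent A c y)) + c *\<^sub>C resolvent A c y = y"
    and resolvent_eqI: "f \<in> dom A \<Longrightarrow> the (A f) + c *\<^sub>C f = z \<Longrightarrow> resolvent A c z = f"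
proof -
  have "\<exists>!f. f \<in> dom A \<and> the (A f) + c *\<^sub>C f = y" for y
    using self_adjoint_shift_surj[OF A c] self_adjoint_shift_inj[OF A c] by metis
  from theI'[OF this] have *: "resolvent A c y \<in> dom A \<and>
      the (A (resolvent A c y)) + c *\<^sub>C resolvent A c y = y" for y
    unfolding resolvent_def .
  then show "resolvent A c y \<in> dom A" "the (A (resolvent A c y)) + c *\<^sub>C resolvent A c y = y"
    by blast+
  show "resolvent A c z = f" if "f \<in> dom A" "the (A f) + c *\<^sub>C f = z"
    using *[of z] by (intro self_adjoint_shift_inj[OF A c _ that(1)]) (simp_all add: that(2))
qed

lemma range_resolvent:
  fixes A :: "'a::complex_hilbert \<rightharpoonup> 'a"
  assumes "self_adjoint A" "cnj c = - c" "cmod c = 1"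
  shows "range (resolvent A c) = dom A"
proof (intro equalityI subsetI)
  fix f assume "f \<in> dom A"
  then have "f = resolvent A c (the (A f) + c *\<^sub>C f)"
    by (rule resolvent_eqI[OF assms _ refl, symmetric])
  then show "f \<in> range (resolvent A c)"
    by (rule range_eqI)
qed (use resolvent_in_dom[OF assms] in blast)

lemma resolvent_linear:
  fixes A :: "'a::complex_hilbert \<rightharpoonup> 'a"
  assumes A: "self_adjoint A" and c: "cnj c = - c" "cmod c = 1"
  shows resolvent_add: "resolvent A c (x + y) = resolvent A c x + resolvent A c y"
    and resolvent_scaleC: "resolvent A c (a *\<^sub>C x) = a *\<^sub>C resolvent A c x"
    and norm_resolvent_le: "norm (resolvent A c x) \<le> norm x"
proof -
  note L = linear_operatorD[OF self_adjointD(1)[OF A]]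
  note R = resolvent_in_dom[OF assms] shift_resolvent[OF assms]
  have "the (A (resolvent A c x + resolvent A c y)) + c *\<^sub>C (resolvent A c x + resolvent A c y) =
    (the (A (resolvent A c x)) + c *\<^sub>C resolvent A c x) +
    (the (A (resolvent A c y)) + c *\<^sub>C resolvent A c y)"
    by (simp add: L(6) R(1) scaleC_add_right)
  then show "resolvent A c (x + y) = resolvent A c x + resolvent A c y"
    unfolding R(2) by (intro resolvent_eqI[OF assms] L(3) R(1))
  have "a *\<^sub>C the (A (resolvent A c x)) + c *\<^sub>C a *\<^sub>C resolvent A c x = a *\<^sub>C x"
    by (subst (2) R(2)[of x, symmetric]) (simp add: scaleC_add_right scaleC_scaleC mult.commute)
  then show "resolvent A c (a *\<^sub>C x) = a *\<^sub>C resolvent A c x"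
    by (intro resolvent_eqI[OF assms]) (simp_all add: L(5,7) R(1))
  show "norm (resolvent A c x) \<le> norm x"
    using norm_self_adjoint_shift[OF assms R(1), of x] unfolding R(2)
    by (intro power2_le_imp_le[of "norm (resolvent A c x)"]) simp_all
qed

lemma bounded_linear_resolvent:
  fixes A :: "'a::complex_hilbert \<rightharpoonup> 'a"
  assumes "self_adjoint A" "cnj c = - c" "cmod c = 1"
  shows "bounded_linear (resolvent A c)"
proof (rule bounded_linear_intro[where K = 1])
  show "resolvent A c (r *\<^sub>R x) = r *\<^sub>R resolvent A c x" for r x
    unfolding scaleC_of_real[symmetric] by (rule resolvent_scaleC[OF assms])
qed (simp_all add: resolvent_add[OF assms] norm_resolvent_le[OF assms])

text \<open>On \<open>dom A\<close> the shifts \<open>A + c\<close> and \<open>A - c\<close> are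
  adjoint to each other since \<open>c\<close> is skew, and this passes to their inverses.\<close>

lemma inner_resolvent:
  fixes A :: "'a::complex_hilbert \<rightharpoonup> 'a"
  assumes A: "self_adjoint A" and c: "cnj c = - c" "cmod c = 1"
  shows "inner (resolvent A c x) y = inner x (resolvent A (- c) y)"
proof -
  have c': "cnj (- c) = - (- c)" "cmod (- c) = 1"
    using c by simp_all
  define f g where fg: "f = resolvent A c x" "g = resolvent A (- c) y"
  have dom: "f \<in> dom A" "g \<in> dom A"
    unfolding fg by (rule resolvent_in_dom[OF A c] resolvent_in_dom[OF A c'])+
  have "inner f (the (A g) + (- c) *\<^sub>C g) = inner (the (A f) + c *\<^sub>C f) g"
    using self_adjoint_symmetric[OF A dom]
    by (simp only: inner_add_left inner_add_right inner_scaleC_left[of c] c(1))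
  then show ?thesis
    using shift_resolvent[OF A c, of x] shift_resolvent[OF A c', of y] by (simp add: fg)
qed

section \<open>Square root of a bounded positive operator\<close>

text \<open>The iteration \<open>Y\<^bsub>n+1\<^esub> = (X + Y\<^bsub>n\<^esub>\<^sup>2) / 2\<close> for \<open>1 - Y = sqrt (1 - X)\<close>, where \<open>X = 1 - E\<close>. Its
  increments are dominated by those of the scalar iteration with \<open>X = 1\<close>.\<close>

lemma ex_operator_square_root:
  fixes E :: "'a::complex_hilbert \<Rightarrow> 'a"
  assumes E: "bounded_linear E" and sym: "\<And>x y. inner (E x) y = inner x (E y)"
    and scaleC: "\<And>c x. E (c *\<^sub>C x) = c *\<^sub>C E x"
    and contr: "\<And>x. norm (x - E x) \<le> norm x"
  shows "\<exists>R. bounded_linear R \<and> (\<forall>x. R (R x) = E x) \<and> (\<forall>x y. inner (R x) y = inner x (R y)) \<and>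
    (\<forall>c x. R (c *\<^sub>C x) = c *\<^sub>C R x) \<and> (\<forall>x. (norm (R x))\<^sup>2 \<le> 2 * inner (R x) x)"
proof -
  define X where "X = Blinfun (\<lambda>x. x - E x)"
  have X: "blinfun_apply X x = x - E x" for x
    unfolding X_def
    by (subst bounded_linear_Blinfun_apply)
      (intro bounded_linear_sub bounded_linear_ident E, rule refl)
  have norm_X: "norm X \<le> 1"
    by (rule norm_blinfun_bound) (simp_all add: X contr)
  define Y where "Y n = ((\<lambda>Y. (1/2) *\<^sub>R (X + (Y o\<^sub>L Y))) ^^ n) 0" for n
  define q where "q n = ((\<lambda>q. (1/2) * (1 + q * q)) ^^ n) (0 :: real)" for n
  have Y_0: "Y 0 = 0" and Y_Suc: "Y (Suc n) = (1/2) *\<^sub>R (X + (Y n o\<^sub>L Y n))" for n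
    by (simp_all add: Y_def)
  have q_0: "q 0 = 0" and q_Suc: "q (Suc n) = (1/2) * (1 + q n * q n)" for n
    by (simp_all add: q_def)
  have q_bounds: "0 \<le> q n \<and> q n \<le> 1" for n
  proof (induction n)
    case (Suc n)
    then have "q n * q n \<le> 1 * 1"
      by (intro mult_mono) auto
    then show ?case
      by (simp add: q_Suc)
  qed (simp add: q_0)
  have norm_Y: "norm (Y n) \<le> q n" for n
  proof (induction n)
    case (Suc n)
    have "norm (Y n o\<^sub>L Y n) \<le> q n * q n"
      using norm_blinfun_compose[of "Y n" "Y n"] mult_mono[OF Suc Suc] q_bounds[of n]
      by (meson norm_ge_zero order_trans)
    then have "norm (X + (Y n o\<^sub>L Y n)) \<le> 1 + q n * q n"
      using norm_X norm_triangle_ineq[of X "Y n o\<^sub>L Y n"] by linarith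
    then show ?case
      by (simp add: Y_Suc q_Suc)
  qed (simp add: q_0 Y_0)
  have incr: "norm (Y (Suc n) - Y n) \<le> q (Suc n) - q n" for n
  proof (induction n)
    case 0
    then show ?case
      using norm_Y[of "Suc 0"] by (simp add: q_0 Y_0)
  next
    case (Suc n)
    let ?D = "Y (Suc n) - Y n"
    \<comment> \<open>Difference of two squares, factored in a form that does not require the
      operators to commute.\<close>
    have split: "Y (Suc (Suc n)) - Y (Suc n) = (1/2) *\<^sub>R ((Y (Suc n) o\<^sub>L ?D) + (?D o\<^sub>L Y n))"
    proof -
      have "(Y (Suc n) o\<^sub>L ?D) + (?D o\<^sub>L Y n) = (Y (Suc n) o\<^sub>L Y (Suc n)) - (Y n o\<^sub>L Y n)"
        by (simp add: bounded_bilinear.diff_left[OF bounded_bilinear_blinfun_compose]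
            bounded_bilinear.diff_right[OF bounded_bilinear_blinfun_compose])
      also have "(1/2) *\<^sub>R \<dots> = (1/2) *\<^sub>R (X + (Y (Suc n) o\<^sub>L Y (Suc n))) - (1/2) *\<^sub>R (X + (Y n o\<^sub>L Y n))"
        by (simp add: scaleR_diff_right scaleR_add_right)
      also have "\<dots> = Y (Suc (Suc n)) - Y (Suc n)"
        by (simp only: Y_Suc[of "Suc n", symmetric] Y_Suc[of n, symmetric])
      finally show ?thesis ..
    qed
    have "norm (Y (Suc n) o\<^sub>L ?D) \<le> q (Suc n) * (q (Suc n) - q n)"
      by (rule order_trans[OF norm_blinfun_compose mult_mono[OF norm_Y Suc]])
        (simp_all add: q_bounds)
    moreover have "norm (?D o\<^sub>L Y n) \<le> (q (Suc n) - q n) * q n"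
      by (rule order_trans[OF norm_blinfun_compose mult_mono[OF Suc norm_Y]])
        (use order_trans[OF norm_ge_zero Suc] in simp_all)
    ultimately have "norm (Y (Suc (Suc n)) - Y (Suc n)) \<le>
      (1/2) * (q (Suc n) * (q (Suc n) - q n) + (q (Suc n) - q n) * q n)"
      unfolding split using norm_triangle_ineq[of "Y (Suc n) o\<^sub>L ?D" "?D o\<^sub>L Y n"] by simp
    also have "\<dots> = (1/2) * (1 + q (Suc n) * q (Suc n)) - (1/2) * (1 + q n * q n)"
      by (simp add: field_simps)
    finally show ?case
      by (simp only: q_Suc[symmetric])
  qed
  \<comment> \<open>The scalar increments bound norms, so \<open>q\<close> increases; bounded by 1,
    it converges, and its telescoping increments are a summable majorant.\<close>
  have "incseq q"
  proof (rule incseq_SucI)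
    show "q k \<le> q (Suc k)" for k
      using order_trans[OF norm_ge_zero incr[of k]] by simp
  qed
  then obtain l where "q \<longlonglongrightarrow> l"
    using incseq_convergent[of q 1] q_bounds by blast
  then have "summable (\<lambda>n. q (Suc n) - q n)"
    by (rule telescope_summable)
  then have "summable (\<lambda>n. Y (Suc n) - Y n)"
    by (rule summable_comparison_test'[where N = 0]) (rule incr)
  then have "convergent (\<lambda>n. \<Sum>k<n. Y (Suc k) - Y k)"
    by (simp add: summable_iff_convergent)
  then have "convergent Y"
    by (simp add: sum_lessThan_telescope Y_0)
  then obtain Z where Z: "Y \<longlonglongrightarrow> Z"
    by (auto simp: convergent_def)
  have "(\<lambda>n. Y (Suc n)) \<longlonglongrightarrow> (1/2) *\<^sub>R (X + (Z o\<^sub>L Z))"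
    unfolding Y_Suc
    by (intro tendsto_intros Z bounded_bilinear.tendsto[OF bounded_bilinear_blinfun_compose])
  \<comment> \<open>Rearranged, the fixed point equation says \<open>(1 - Z)^2 = 1 - X = E\<close>,
    so \<open>1 - Z\<close> is the root.\<close>
  then have fixed: "Z = (1/2) *\<^sub>R (X + (Z o\<^sub>L Z))"
    by (rule LIMSEQ_unique[OF LIMSEQ_Suc[OF Z]])
  have Z_fixed: "2 *\<^sub>R blinfun_apply Z x = x - E x + blinfun_apply Z (blinfun_apply Z x)" for x
    by (subst (1) fixed) (simp add: blinfun.scaleR_left blinfun.add_left X)
  have norm_Z: "norm Z \<le> 1"
    by (rule Lim_bounded[OF tendsto_norm[OF Z]]) (meson norm_Y q_bounds order_trans)
  have norm_Z_le: "norm (blinfun_apply Z x) \<le> norm x" for x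
    using norm_blinfun[of Z x] mult_right_mono[OF norm_Z norm_ge_zero[of x]] by simp
  have Y_lim: "(\<lambda>n. blinfun_apply (Y n) x) \<longlonglongrightarrow> blinfun_apply Z x" for x
    by (intro tendsto_intros Z)
  have Y_sym: "inner (blinfun_apply (Y n) x) y = inner x (blinfun_apply (Y n) y)" for n x y
    by (induction n arbitrary: x y)
      (simp_all add: Y_0 Y_Suc X blinfun.scaleR_left blinfun.add_left inner_add_left inner_add_right
        inner_diff_left inner_diff_right sym)
  have Z_sym: "inner (blinfun_apply Z x) y = inner x (blinfun_apply Z y)" for x y
  proof (rule LIMSEQ_unique)
    show "(\<lambda>n. inner (blinfun_apply (Y n) x) y) \<longlonglongrightarrow> inner (blinfun_apply Z x) y"
      by (intro tendsto_intros Y_lim)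
    show "(\<lambda>n. inner (blinfun_apply (Y n) x) y) \<longlonglongrightarrow> inner x (blinfun_apply Z y)"
      unfolding Y_sym by (intro tendsto_intros Y_lim)
  qed
  have Y_scaleC: "blinfun_apply (Y n) (c *\<^sub>C x) = c *\<^sub>C blinfun_apply (Y n) x" for n c x
  proof (induction n arbitrary: x)
    case (Suc n)
    have "c *\<^sub>C (r *\<^sub>R y) = r *\<^sub>R (c *\<^sub>C y)" for r and y :: 'a
      by (simp add: scaleC_scaleC mult.commute flip: scaleC_of_real)
    then show ?case
      by (simp add: Y_Suc X blinfun.scaleR_left blinfun.add_left Suc scaleC scaleC_add_right
          scaleC_diff_right)
  qed (simp add: Y_0)
  have Z_scaleC: "blinfun_apply Z (c *\<^sub>C x) = c *\<^sub>C blinfun_apply Z x" for c x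
  proof (rule LIMSEQ_unique[OF Y_lim])
    show "(\<lambda>n. blinfun_apply (Y n) (c *\<^sub>C x)) \<longlonglongrightarrow> c *\<^sub>C blinfun_apply Z x"
      unfolding Y_scaleC by (intro bounded_linear.tendsto[OF bounded_linear_scaleC] Y_lim)
  qed
  show ?thesis
  proof (intro exI[of _ "\<lambda>x. x - blinfun_apply Z x"] conjI allI)
    show "bounded_linear (\<lambda>x. x - blinfun_apply Z x)"
      by (intro bounded_linear_sub bounded_linear_ident blinfun.bounded_linear_right)
    show "x - blinfun_apply Z x - blinfun_apply Z (x - blinfun_apply Z x) = E x" for x
      using Z_fixed[of x] by (simp add: blinfun.diff_right scaleR_2 algebra_simps)
    show "inner (x - blinfun_apply Z x) y = inner x (y - blinfun_apply Z y)" for x y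
      by (simp add: inner_diff_left inner_diff_right Z_sym)
    show "c *\<^sub>C x - blinfun_apply Z (c *\<^sub>C x) = c *\<^sub>C (x - blinfun_apply Z x)" for c x
      by (simp add: Z_scaleC scaleC_diff_right)
    \<comment> \<open>Expanding both sides reduces this to \<open>norm (Z x) \<le> norm x\<close>.
      It is the form of positivity that later bounds the inverse of the root from below.\<close>
    show "(norm (x - blinfun_apply Z x))\<^sup>2 \<le> 2 * inner (x - blinfun_apply Z x) x" for x
    proof -
      have "(norm (blinfun_apply Z x))\<^sup>2 \<le> (norm x)\<^sup>2"
        using norm_Z_le by (intro power_mono) simp_all
      then show ?thesis
        unfolding power2_norm_eq_inner by (simp add: inner_diff_left inner_diff_right inner_commute)
    qed
  qed
qed

section \<open>A positive definite operator from two disjoint domains\<close>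

lemma imaginary_unit_skew:
  "cnj \<i> = - \<i>" "cmod \<i> = 1" "cnj (- \<i>) = - (- \<i>)" "cmod (- \<i>) = 1"
  by simp_all

text \<open>With \<open>T\<close>, \<open>C\<close> the resolvents of \<open>A\<close>, \<open>S\<close> at \<open>-\<i>\<close>, the operator is \<open>B = (T T\<^sup>* + C C\<^sup>*)\<^sup>-\<^sup>1\<^sup>/\<^sup>2\<close>. The map
  \<open>B\<^sup>-\<^sup>1 x \<mapsto> (T\<^sup>* x, C\<^sup>* x)\<close> is isometric, and since the ranges of \<open>T\<close> and \<open>C\<close> are disjoint its
  range is dense in \<open>H \<times> H\<close>. Under the resulting unitary identification of \<open>H\<close> with \<open>H \<times> H\<close>,
  \<open>B dom A\<close> becomes \<open>H \<times> 0\<close> and \<open>B dom S\<close> becomes \<open>0 \<times> H\<close>.\<close>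

lemma ex_positive_definite_of_disjoint_domains:
  fixes A S :: "'a::complex_hilbert \<rightharpoonup> 'a"
  assumes A: "self_adjoint A" and S: "self_adjoint S" and disj: "dom S \<inter> dom A = {0}"
  shows "\<exists>B. self_adjoint B \<and> positive_definite B \<and> dom A \<subseteq> dom B \<and>
         closure ((\<lambda>f. the (B f)) ` dom A) \<inter> dom B = {0}"
proof -
  note i = imaginary_unit_skew
  define T where "T = resolvent A \<i>"
  define T' where "T' = resolvent A (- \<i>)"
  define C where "C = resolvent S \<i>"
  define C' where "C' = resolvent S (- \<i>)"
  note defs = T_def T'_def C_def C'_def
  have lin: "bounded_linear T" "bounded_linear T'" "bounded_linear C" "bounded_linear C'"
    unfolding defs by (intro bounded_linear_resolvent A S i)+
  note add = lin[THEN bounded_linear.linear, THEN linear_add]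
  note diff = lin[THEN bounded_linear.linear, THEN linear_diff]
  note zero = lin[THEN bounded_linear.linear, THEN linear_0]
  have contr: "norm (T x) \<le> norm x" "norm (C x) \<le> norm x" for x
    unfolding defs by (intro norm_resolvent_le A S i)+
  have sc: "T (c *\<^sub>C x) = c *\<^sub>C T x" "T' (c *\<^sub>C x) = c *\<^sub>C T' x"
    "C (c *\<^sub>C x) = c *\<^sub>C C x" "C' (c *\<^sub>C x) = c *\<^sub>C C' x" for c x
    unfolding defs by (intro resolvent_scaleC A S i)+
  have adj: "inner (T x) y = inner x (T' y)" "inner (C x) y = inner x (C' y)" for x y
    unfolding defs by (intro inner_resolvent A S i)+
  have adj': "inner (T' x) y = inner x (T y)" "inner (C' x) y = inner x (C y)" for x y
    using adj[of y x] by (simp_all add: inner_commute)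
  have ran: "range T = dom A" "range C = dom S"
    unfolding defs by (intro range_resolvent A S i)+
  have T'_inj: "x = 0" if "T' x = 0" for x
    using shift_resolvent[OF A i(3,4), of x] that linear_operatorD(7)[OF self_adjointD(1)[OF A], of 0 0]
      linear_operatorD(2)[OF self_adjointD(1)[OF A]]
    unfolding T'_def by simp
  have T_inj: "x = 0" if "T x = 0" for x
    using shift_resolvent[OF A i(1,2), of x] that linear_operatorD(7)[OF self_adjointD(1)[OF A], of 0 0]
      linear_operatorD(2)[OF self_adjointD(1)[OF A]]
    unfolding T_def by simp
  have C_inj: "x = 0" if "C x = 0" for x
    using shift_resolvent[OF S i(1,2), of x] that linear_operatorD(7)[OF self_adjointD(1)[OF S], of 0 0]
      linear_operatorD(2)[OF self_adjointD(1)[OF S]]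
    unfolding C_def by simp

  define E where "E x = T (T' x) + C (C' x)" for x
  have E_inner: "inner (E x) y = inner (T' x) (T' y) + inner (C' x) (C' y)" for x y
    by (simp add: E_def inner_add_left adj)
  have E_lin: "bounded_linear E"
    unfolding E_def
    by (intro bounded_linear_add bounded_linear_compose[OF lin(1) lin(2)]
        bounded_linear_compose[OF lin(3) lin(4)])
  have E_sym: "inner (E x) y = inner x (E y)" for x y
    by (simp add: E_inner) (simp add: E_def inner_add_right adj')
  have E_scaleC: "E (c *\<^sub>C x) = c *\<^sub>C E x" for c x
    by (simp add: E_def sc scaleC_add_right)
  \<comment> \<open>Equivalent to \<open>inner (E x) (E x) \<le> 2 * inner (E x) x\<close>, which
    holds because \<open>T\<close> and \<open>C\<close> are contractions. The square root thus
    exists without rescaling \<open>E\<close>.\<close>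
  have E_contr: "norm (x - E x) \<le> norm x" for x
  proof -
    have "norm (E x) \<le> norm (T' x) + norm (C' x)"
      unfolding E_def by (rule norm_triangle_le[OF add_mono[OF contr]])
    then have "(norm (E x))\<^sup>2 \<le> (norm (T' x) + norm (C' x))\<^sup>2"
      by (rule power_mono) simp
    also have "\<dots> \<le> 2 * ((norm (T' x))\<^sup>2 + (norm (C' x))\<^sup>2)"
      using sum_squares_bound[of "norm (T' x)" "norm (C' x)"] by (simp add: power2_sum)
    also have "\<dots> = 2 * inner (E x) x"
      by (simp add: E_inner power2_norm_eq_inner)
    finally have "(norm (x - E x))\<^sup>2 \<le> (norm x)\<^sup>2"
      unfolding power2_norm_eq_inner
      by (simp add: inner_diff_left inner_diff_right inner_commute)
    then show ?thesis
      by (rule power2_le_imp_le) simp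
  qed
  obtain R where R: "bounded_linear R" "\<And>x. R (R x) = E x"
    "\<And>x y. inner (R x) y = inner x (R y)" "\<And>c x. R (c *\<^sub>C x) = c *\<^sub>C R x"
    "\<And>x. (norm (R x))\<^sup>2 \<le> 2 * inner (R x) x"
    using ex_operator_square_root[OF E_lin E_sym E_scaleC E_contr] by blast
  note R_lin = R(1)[THEN bounded_linear.linear]
  have R_inner: "inner (R x) (R y) = inner (T' x) (T' y) + inner (C' x) (C' y)" for x y
    using E_inner[of x y] R(2)[of x] R(3)[of "R x" y] by simp
  have R_inj: "x = 0" if "R x = 0" for x
  proof -
    have "inner (T' x) (T' x) + inner (C' x) (C' x) = 0"
      using R_inner[of x x] that by simp
    then have "inner (T' x) (T' x) = 0"
      by (metis inner_ge_zero add_nonneg_eq_0_iff)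
    then show ?thesis
      using T'_inj[of x] by simp
  qed
  have "inj R"
    using R_inj linear_injective_0[OF R_lin] by blast

  have dist_R: "dist (R x) (R y) = dist (T' x, C' x) (T' y, C' y)" for x y
  proof -
    have "(norm (R (x - y)))\<^sup>2 = (norm (T' (x - y), C' (x - y)))\<^sup>2"
      unfolding power2_norm_eq_inner by (simp add: R_inner inner_prod_def)
    then have "norm (R (x - y)) = norm (T' (x - y), C' (x - y))"
      by simp
    then show ?thesis
      by (simp add: dist_norm linear_diff[OF R_lin] diff)
  qed
  have dense: "closure (range (\<lambda>x. (T' x, C' x))) = UNIV"
  proof (rule closure_subspace_eq_UNIV)
    have "linear (\<lambda>x. (T' x, C' x))"
      using lin by (intro bounded_linear.linear bounded_linear_Pair)
    then show "subspace (range (\<lambda>x. (T' x, C' x)))"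
      by (intro linear_subspace_image subspace_UNIV)
  next
    \<comment> \<open>By adjointness, orthogonality to the range says \<open>T u + C v = 0\<close>.
      Then \<open>T u = C (- v)\<close> lies in both domains, and disjointness with injectivity of
      the resolvents gives \<open>u = v = 0\<close>.\<close>
    fix p :: "'a \<times> 'a" assume p: "\<And>q. q \<in> range (\<lambda>x. (T' x, C' x)) \<Longrightarrow> inner p q = 0"
    obtain u v where uv: "p = (u, v)"
      by (cases p)
    have "inner (T u + C v) x = 0" for x
      using p[of "(T' x, C' x)"] by (simp add: uv inner_prod_def inner_add_left adj)
    then have "T u + C v = 0"
      using inner_eq_zero_iff by blast
    then have "T u + C v = C (- v) + C v"
      using add(3)[of "- v" v] zero by simp
    then have "T u = C (- v)"
      by simp
    then have "T u \<in> dom S \<inter> dom A"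
      using ran by (metis IntI rangeI)
    then have "T u = 0"
      using disj by blast
    then have "u = 0" "v = 0"
      using \<open>T u + C v = 0\<close> T_inj[of u] C_inj[of v] by simp_all
    then show "p = 0"
      by (simp add: uv zero_prod_def)
  qed
  \<comment> \<open>The vector \<open>z\<close> corresponds to the pair \<open>(u, v)\<close>: by
    density pairs \<open>(T' (x n), C' (x n))\<close> approach it, the isometry makes
    \<open>R (x n)\<close> Cauchy, and one more application of \<open>R\<close> computes
    \<open>R z\<close> through \<open>E\<close>.\<close>
  have approx: "\<exists>x z. (\<lambda>n. T' (x n)) \<longlonglongrightarrow> u \<and> (\<lambda>n. C' (x n)) \<longlonglongrightarrow> v \<and>
      (\<lambda>n. R (x n)) \<longlonglongrightarrow> z \<and> R z = T u + C v" for u v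
  proof -
    have "(u, v) \<in> closure (range (\<lambda>x. (T' x, C' x)))"
      using dense by blast
    then obtain w where w: "\<And>n. w n \<in> range (\<lambda>x. (T' x, C' x))" "w \<longlonglongrightarrow> (u, v)"
      unfolding closure_sequential by blast
    then obtain x where x: "\<And>n. w n = (T' (x n), C' (x n))"
      unfolding image_iff by metis
    have limT: "(\<lambda>n. T' (x n)) \<longlonglongrightarrow> u" and limC: "(\<lambda>n. C' (x n)) \<longlonglongrightarrow> v"
      using tendsto_fst[OF w(2)] tendsto_snd[OF w(2)] by (simp_all add: x)
    have "Cauchy w"
      using w(2) by (rule LIMSEQ_imp_Cauchy)
    then have "Cauchy (\<lambda>n. R (x n))"
      unfolding Cauchy_def by (simp only: dist_R x)
    then obtain z where z: "(\<lambda>n. R (x n)) \<longlonglongrightarrow> z"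
      using Cauchy_convergent convergent_def by blast
    have "(\<lambda>n. R (R (x n))) \<longlonglongrightarrow> T u + C v"
      unfolding R(2) E_def
      by (intro tendsto_add bounded_linear.tendsto[OF lin(1)] bounded_linear.tendsto[OF lin(3)]
          limT limC)
    then have "R z = T u + C v"
      using bounded_linear.tendsto[OF R(1) z] LIMSEQ_unique by blast
    then show ?thesis
      using limT limC z by blast
  qed

  define B where "B g = (if g \<in> range R then Some (inv R g) else None)" for g
  have B_iff: "B g = Some h \<longleftrightarrow> R h = g" for g h
    using \<open>inj R\<close> by (auto simp: B_def inv_f_f f_inv_into_f dest: injD[OF \<open>inj R\<close>])
  have dom_B: "dom B = range R"
    by (auto simp: B_def dom_def)
  have B_R: "B (R x) = Some x" for x
    by (simp add: B_iff)
  have "linear_operator B"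
    unfolding linear_operator_def complex_vector.subspace_def dom_B
  proof (intro conjI ballI allI)
    show "0 \<in> range R"
      using linear_0[OF R_lin] by (metis rangeI)
    fix f assume "f \<in> range R"
    then obtain x where x: "f = R x" ..
    show "c *\<^sub>C f \<in> range R" for c
      unfolding x R(4)[symmetric] by simp
    show "the (B (c *\<^sub>C f)) = c *\<^sub>C the (B f)" for c
      unfolding x R(4)[symmetric] B_R by simp
    fix g assume "g \<in> range R"
    then obtain y where y: "g = R y" ..
    show "f + g \<in> range R"
      unfolding x y linear_add[OF R_lin, symmetric] by simp
    show "the (B (f + g)) = the (B f) + the (B g)"
      unfolding x y linear_add[OF R_lin, symmetric] B_R by simp
  qed
  have "closure (dom B) = UNIV"
    unfolding dom_B
  proof (rule closure_subspace_eq_UNIV)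
    show "subspace (range R)"
      by (intro linear_subspace_image[OF R_lin] subspace_UNIV)
    fix x assume x: "\<And>y. y \<in> range R \<Longrightarrow> inner x y = 0"
    have "inner (R x) (R x) = 0"
      unfolding R(3) by (rule x) simp
    then show "x = 0"
      using R_inj[of x] by simp
  qed
  have "self_adjoint B"
    unfolding self_adjoint_iff
  proof (intro conjI allI)
    fix g h
    \<comment> \<open>Elements of \<open>dom B\<close> are the \<open>R x\<close>, with
      \<open>B (R x) = x\<close>; symmetry of \<open>R\<close> turns the adjoint relation into an
      identity for all \<open>x\<close>, which determines \<open>R h\<close>.\<close>
    have "(\<forall>f\<in>dom B. inner (the (B f)) g = inner f h) \<longleftrightarrow> (\<forall>x. inner x g = inner x (R h))"
      by (simp add: dom_B B_R R(3))
    also have "\<dots> \<longleftrightarrow> R h = g"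
      using vector_eq_rdot[of g "R h"] by (auto simp: inner_commute)
    finally show "B g = Some h \<longleftrightarrow> (\<forall>f\<in>dom B. inner (the (B f)) g = inner f h)"
      by (simp add: B_iff)
  qed fact+
  moreover have "positive_definite B"
    unfolding positive_definite_def
  \<comment> \<open>The constant comes from the factor 2 in the positivity bound on
    \<open>R\<close>, read with \<open>f = R x\<close> and \<open>B f = x\<close>.\<close>
  proof (intro exI[of _ "1/2"] conjI ballI)
    fix f assume "f \<in> dom B"
    then obtain x where x: "f = R x"
      unfolding dom_B ..
    show "Re (cinner (the (B f)) f) \<ge> 1/2 * (norm f)\<^sup>2"
      using R(5)[of x] by (simp add: x B_R Re_cinner inner_commute)
  qed simp
  moreover have "dom A \<subseteq> dom B"
  proof
    fix f assume "f \<in> dom A"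
    then obtain h where "f = T h"
      using ran(1) by blast
    \<comment> \<open>The pair \<open>(h, 0)\<close> exhibits \<open>T h\<close> as a value of
      \<open>R\<close>.\<close>
    moreover obtain z where "R z = T h + C 0"
      using approx[of h 0] by blast
    ultimately show "f \<in> dom B"
      unfolding dom_B using zero(3) by (metis add.right_neutral rangeI)
  qed
  moreover have "closure ((\<lambda>f. the (B f)) ` dom A) \<inter> dom B = {0}"
  proof (intro equalityI subsetI)
    fix y assume y: "y \<in> closure ((\<lambda>f. the (B f)) ` dom A) \<inter> dom B"
    then obtain x where x: "y = R x"
      unfolding dom_B by blast
    \<comment> \<open>For \<open>f\<close> in \<open>dom A\<close> the vector \<open>B f\<close>
      corresponds to a pair \<open>(h, 0)\<close>, while \<open>z'\<close> with
      \<open>R z' = C v\<close> corresponds to \<open>(0, v)\<close>. These are orthogonal, so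
      \<open>y = R x\<close> is orthogonal to \<open>z'\<close>; moving \<open>R\<close> across
      makes \<open>x\<close> orthogonal to the range of \<open>C\<close>, which is the dense set
      \<open>dom S\<close>.\<close>
    have "inner x (C v) = 0" for v
    proof -
      obtain b z' where b: "(\<lambda>n. T' (b n)) \<longlonglongrightarrow> 0" "(\<lambda>n. C' (b n)) \<longlonglongrightarrow> v"
        "(\<lambda>n. R (b n)) \<longlonglongrightarrow> z'" "R z' = T 0 + C v"
        using approx[of 0 v] by blast
      have "inner (the (B f)) z' = 0" if f: "f \<in> dom A" for f
      proof -
        obtain h where h: "f = T h"
          using ran(1) f by blast
        obtain a z where a: "(\<lambda>n. T' (a n)) \<longlonglongrightarrow> h" "(\<lambda>n. C' (a n)) \<longlonglongrightarrow> 0"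
          "(\<lambda>n. R (a n)) \<longlonglongrightarrow> z" "R z = T h + C 0"
          using approx[of h 0] by blast
        have "the (B f) = z"
          using B_iff[of f z] a(4) by (simp add: h zero)
        moreover have "inner z z' = inner h 0 + inner 0 v"
        proof (rule LIMSEQ_unique)
          show "(\<lambda>n. inner (R (a n)) (R (b n))) \<longlonglongrightarrow> inner z z'"
            by (intro tendsto_inner a b)
          show "(\<lambda>n. inner (R (a n)) (R (b n))) \<longlonglongrightarrow> inner h 0 + inner 0 v"
            unfolding R_inner by (intro tendsto_add tendsto_inner a b)
        qed
        ultimately show ?thesis
          by simp
      qed
      then have "(\<lambda>f. the (B f)) ` dom A \<subseteq> {y. inner y z' = 0}"
        by blast
      then have "closure ((\<lambda>f. the (B f)) ` dom A) \<subseteq> {y. inner y z' = 0}"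
        by (rule closure_minimal) (intro closed_Collect_eq continuous_intros)
      then have "inner (R x) z' = 0"
        using y x by blast
      then show ?thesis
        by (simp add: R(3) b(4) zero)
    qed
    then have "x = 0"
      by (intro orthogonal_to_dense[OF self_adjointD(2)[OF S, folded ran(2)], of x]) (metis imageE)
    then show "y \<in> {0}"
      by (simp add: x linear_0[OF R_lin])
  next
    have 0: "0 \<in> dom A" "0 \<in> dom B" "the (B 0) = 0"
      using linear_operatorD(2)[OF self_adjointD(1)[OF A]] B_R[of 0]
      by (auto simp: linear_0[OF R_lin])
    have "0 \<in> (\<lambda>f. the (B f)) ` dom A"
      using 0(1,3) by (metis imageI)
    then have "0 \<in> closure ((\<lambda>f. the (B f)) ` dom A)"
      by (rule subsetD[OF closure_subset])
    then show "y \<in> closure ((\<lambda>f. the (B f)) ` dom A) \<inter> dom B" if "y \<in> {0}" for y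
      using that 0(2) by simp
  qed
  ultimately show ?thesis
    by blast
qed

section \<open>From positive definite operators to subspaces and symmetries\<close>

text \<open>For \<open>M = clos (B dom A)\<close> the first intersection is trivial because
  \<open>dom A \<subseteq> dom B\<close>. If \<open>x\<close> in \<open>dom A\<close> is orthogonal
  to \<open>M\<close>, then \<open>(B x, g) = (x, B g) = 0\<close> for all \<open>g\<close> in the
  dense set \<open>dom A\<close>, so \<open>B x = 0\<close>, and positive definiteness gives
  \<open>x = 0\<close>.\<close>

lemma ex_subspace_of_positive_definite:
  fixes A B :: "'a::complex_hilbert \<rightharpoonup> 'a"
  assumes A: "self_adjoint A" and B: "self_adjoint B" "positive_definite B" "dom A \<subseteq> dom B"
    and disj: "closure ((\<lambda>f. the (B f)) ` dom A) \<inter> dom B = {0}"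
  shows "\<exists>M. csubspace M \<and> closed M \<and> M \<inter> dom A = {0} \<and> orthogonal_complement M \<inter> dom A = {0}"
proof -
  note LA = linear_operatorD[OF self_adjointD(1)[OF A]]
  note LB = linear_operatorD[OF self_adjointD(1)[OF B(1)]]
  define M where "M = closure ((\<lambda>f. the (B f)) ` dom A)"
  have B0: "the (B 0) = 0"
    using LB(7)[OF LB(2), of 0] by simp
  have "csubspace ((\<lambda>f. the (B f)) ` dom A)"
    unfolding complex_vector.subspace_def
  proof (intro conjI ballI allI)
    show "0 \<in> (\<lambda>f. the (B f)) ` dom A"
      using LA(2) B0 by (metis imageI)
    show "x + y \<in> (\<lambda>f. the (B f)) ` dom A"
      if xy: "x \<in> (\<lambda>f. the (B f)) ` dom A" "y \<in> (\<lambda>f. the (B f)) ` dom A" for x y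
    proof -
      obtain f g where fg: "f \<in> dom A" "g \<in> dom A" "x = the (B f)" "y = the (B g)"
        using xy by blast
      have "x + y = the (B (f + g))"
        unfolding fg by (rule LB(6)[symmetric]) (use fg B(3) in blast)+
      then show ?thesis
        using LA(3)[OF fg(1,2)] by blast
    qed
    show "c *\<^sub>C x \<in> (\<lambda>f. the (B f)) ` dom A" if x: "x \<in> (\<lambda>f. the (B f)) ` dom A" for c x
    proof -
      obtain f where f: "f \<in> dom A" "x = the (B f)"
        using x by blast
      have "c *\<^sub>C x = the (B (c *\<^sub>C f))"
        unfolding f by (rule LB(7)[symmetric]) (use f B(3) in blast)
      then show ?thesis
        using LA(5)[OF f(1)] by blast
    qed
  qed
  then have M: "csubspace M"
    unfolding M_def by (rule csubspace_closure)
  have "x = 0" if "x \<in> orthogonal_complement M" "x \<in> dom A" for x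
  proof -
    have "the (B x) = 0"
    proof (rule orthogonal_to_dense[OF self_adjointD(2)[OF A]])
      fix g assume g: "g \<in> dom A"
      have "the (B g) \<in> M"
        unfolding M_def by (rule subsetD[OF closure_subset imageI[OF g]])
      then have "inner x (the (B g)) = 0"
        using that(1) unfolding orthogonal_complement_csubspace[OF M] by blast
      moreover have "x \<in> dom B" "g \<in> dom B"
        using that(2) g B(3) by blast+
      ultimately show "inner (the (B x)) g = 0"
        using self_adjoint_symmetric[OF B(1)] by simp
    qed
    moreover obtain m where "m > 0" "m * (norm x)\<^sup>2 \<le> Re (cinner (the (B x)) x)"
      using B(2,3) \<open>x \<in> dom A\<close> unfolding positive_definite_def by blast
    ultimately have "m * (norm x)\<^sup>2 \<le> 0"
      by (simp add: Re_cinner)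
    then show "x = 0"
      using \<open>m > 0\<close> by (simp add: mult_le_0_iff)
  qed
  moreover have "0 \<in> M" "0 \<in> orthogonal_complement M"
    using complex_vector.subspace_0[OF M] by (simp_all add: orthogonal_complement_csubspace[OF M])
  moreover have "closed M"
    by (simp add: M_def)
  moreover have "x = 0" if "x \<in> M" "x \<in> dom A" for x
    using that disj B(3) unfolding M_def by blast
  ultimately show ?thesis
    using M LA(2) by (intro exI[of _ M] conjI equalityI subsetI) simp_all
qed

text \<open>Let \<open>J = 2 P - 1\<close> with \<open>P\<close> the projection onto
  \<open>M\<close>. If \<open>f\<close> and \<open>J f\<close> are in \<open>dom A\<close>, so is
  their sum \<open>2 P f\<close>, which also lies in \<open>M\<close>. Hence \<open>P f = 0\<close>,
  so \<open>f\<close> is in the orthogonal complement and in \<open>dom A\<close>, and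
  vanishes.\<close>

lemma ex_fundamental_symmetry_of_subspace:
  fixes A :: "'a::complex_hilbert \<rightharpoonup> 'a"
  assumes A: "self_adjoint A" and M: "csubspace M" "closed M"
    and disj: "M \<inter> dom A = {0}" "orthogonal_complement M \<inter> dom A = {0}"
  shows "\<exists>J. fundamental_symmetry J \<and> dom (J \<circ>\<^sub>m A \<circ>\<^sub>m J) \<inter> dom A = {0}"
proof -
  note L = linear_operatorD[OF self_adjointD(1)[OF A]]
  note M_ops = complex_vector.subspace_0[OF M(1)] complex_vector.subspace_add[OF M(1)]
    complex_vector.subspace_diff[OF M(1)] complex_vector.subspace_scale[OF M(1)]
  obtain P where P: "\<And>x. P x \<in> M" "\<And>x y. y \<in> M \<Longrightarrow> inner (x - P x) y = 0"
    using ex_orthogonal_projection[OF csubspace_imp_subspace[OF M(1)] M(2)] by metis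
  \<comment> \<open>The projection was obtained by choice; its additivity, complex homogeneity and
    idempotence all follow from this uniqueness.\<close>
  have P_eqI: "P x = p" if "p \<in> M" "\<And>y. y \<in> M \<Longrightarrow> inner (x - p) y = 0" for x p
  proof -
    have "P x - p \<in> M"
      by (intro M_ops P that)
    then have "inner (x - p) (P x - p) - inner (x - P x) (P x - p) = 0"
      using P(2) that(2) by simp
    then have "inner (P x - p) (P x - p) = 0"
      by (simp flip: inner_diff_left)
    then show ?thesis
      by simp
  qed
  have P_add: "P (x + y) = P x + P y" for x y
  proof (rule P_eqI)
    show "P x + P y \<in> M"
      by (intro M_ops P)
    show "inner (x + y - (P x + P y)) z = 0" if "z \<in> M" for z
      using P(2)[OF that, of x] P(2)[OF that, of y] by (simp add: inner_diff_left inner_add_left)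
  qed
  have P_scaleC: "P (c *\<^sub>C x) = c *\<^sub>C P x" for c x
  proof (rule P_eqI)
    show "c *\<^sub>C P x \<in> M"
      by (intro M_ops P)
    show "inner (c *\<^sub>C x - c *\<^sub>C P x) z = 0" if "z \<in> M" for z
      using P(2)[of "cnj c *\<^sub>C z" x] M_ops(4)[OF that]
      unfolding scaleC_diff_right[symmetric] inner_scaleC_left[of c] by blast
  qed
  have P_sym: "inner (P x) y = inner x (P y)" for x y
    using P(2)[OF P(1)[of y], of x] P(2)[OF P(1)[of x], of y]
    by (simp add: inner_diff_left inner_diff_right inner_commute)
  have P_idem: "P (P x) = P x" for x
    by (rule P_eqI) (simp_all add: P(1))
  define j where "j x = P x + P x - x" for x
  define J where "J x = Some (j x)" for x
  have dom_J: "dom J = UNIV"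
    by (auto simp: J_def)
  have "P (P x + P x) = P (j x) + P x" for x
    by (simp add: j_def flip: P_add)
  then have jj: "j (j x) = x" for x
    using P_add[of "P x" "P x"] by (simp add: j_def P_idem)
  have j_sym: "inner (j x) y = inner x (j y)" for x y
    by (simp add: j_def inner_add_left inner_add_right inner_diff_left inner_diff_right P_sym)
  have lin: "linear_operator J"
    unfolding linear_operator_def dom_J
    by (simp add: J_def j_def P_add P_scaleC scaleC_diff_right scaleC_add_right
        complex_vector.subspace_UNIV)
  have "norm (j x) = norm x" for x
    by (simp add: norm_eq_sqrt_inner j_sym jj)
  then have "bounded_operator J"
    unfolding bounded_operator_def by (intro exI[of _ 1]) (simp add: J_def)
  moreover have "adjoint_op J = J"
  proof
    fix g
    have "adjoint_op J g = Some (j g)"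
      using adjoint_op_eq_Some_iff[OF lin] by (simp add: dom_J J_def j_sym)
    then show "adjoint_op J g = J g"
      by (simp add: J_def)
  qed
  moreover have "J \<circ>\<^sub>m J = Some"
    by (simp add: fun_eq_iff J_def jj)
  ultimately have J: "fundamental_symmetry J"
    using lin dom_J by (simp add: fundamental_symmetry_def)
  have dom: "dom (J \<circ>\<^sub>m A \<circ>\<^sub>m J) = {f. j f \<in> dom A}"
    by (auto simp: dom_operator_product dom_J J_def)
  have "f = 0" if f: "j f \<in> dom A" "f \<in> dom A" for f
  proof -
    have "P f + P f \<in> dom A"
      using L(3)[OF f] by (simp add: j_def)
    then have "P f + P f = 0"
      using disj(1) M_ops(2)[OF P(1) P(1)] by blast
    then have "P f = 0"
      by (simp flip: scaleR_2)
    then have "f \<in> orthogonal_complement M"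
      using P(2)[of _ f] by (simp add: orthogonal_complement_csubspace[OF M(1)])
    then show ?thesis
      using disj(2) f(2) by blast
  qed
  moreover have "j 0 = 0"
    using P_scaleC[of 0 0] by (simp add: j_def)
  ultimately have "dom (J \<circ>\<^sub>m A \<circ>\<^sub>m J) \<inter> dom A = {0}"
    unfolding dom using L(2) by auto
  then show ?thesis
    using J by blast
qed

section \<open>Conjugation by unitary operators\<close>

text \<open>Makes \<open>J A J\<close> an instance of conjugation of \<open>A\<close> by a unitary
  operator.\<close>

lemma fundamental_symmetry_imp_unitary:
  assumes "fundamental_symmetry J"
  shows "unitary_operator J" "adjoint_op J = J"
  using assms by (simp_all add: fundamental_symmetry_def unitary_operator_def)

text \<open>\<open>U\<close> acts as a norm-preserving bijection \<open>u\<close> with inverse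
  \<open>v\<close>. The equivalence
  \<open>S g = Some h \<longleftrightarrow> A (u g) = Some (u h)\<close> carries the adjoint
  relation from \<open>A\<close> to \<open>S\<close>, and a bound for \<open>S\<close> would carry
  back to \<open>A\<close>.\<close>

lemma self_adjoint_unitary_conjugate:
  fixes A U :: "'a::complex_hilbert \<rightharpoonup> 'a"
  assumes A: "self_adjoint A" "\<not> bounded_operator A" and U: "unitary_operator U"
  shows "self_adjoint (adjoint_op U \<circ>\<^sub>m A \<circ>\<^sub>m U)" "\<not> bounded_operator (adjoint_op U \<circ>\<^sub>m A \<circ>\<^sub>m U)"
proof -
  note L = linear_operatorD[OF self_adjointD(1)[OF A(1)]]
  have U': "linear_operator U" "dom U = UNIV" "adjoint_op U \<circ>\<^sub>m U = Some"
    "U \<circ>\<^sub>m adjoint_op U = Some"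
    using U by (simp_all add: unitary_operator_def)
  define u where "u x = the (U x)" for x
  define v where "v x = the (adjoint_op U x)" for x
  have U_eq: "U x = Some (u x)" for x
    using U'(2) by (metis UNIV_I domD option.sel u_def)
  have V_eq: "adjoint_op U x = Some (v x)" for x
    using fun_cong[OF U'(4), of x] by (cases "adjoint_op U x") (simp_all add: v_def map_comp_def)
  have vu: "v (u x) = x" and uv: "u (v x) = x" for x
    using fun_cong[OF U'(3), of x] fun_cong[OF U'(4), of x]
    by (simp_all add: map_comp_def U_eq V_eq)
  have adj: "inner (u x) y = inner x (v y)" for x y
    using adjoint_op_eq_Some_iff[OF U'(1), of y "v y"] V_eq[of y] U'(2)
    by (simp add: u_def)
  have adj': "inner (v x) y = inner x (u y)" for x y
    using adj[of y x] by (simp add: inner_commute)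
  have norm_u: "norm (u x) = norm x" and norm_v: "norm (v x) = norm x" for x
    by (simp_all add: norm_eq_sqrt_inner adj adj' uv vu)
  have u_add: "u (x + y) = u x + u y" and u_scaleC: "u (c *\<^sub>C x) = c *\<^sub>C u x" for x y c
    using linear_operatorD(6)[OF U'(1), of x y] linear_operatorD(7)[OF U'(1), of x c] U'(2)
    by (simp_all add: u_def)
  have v_add: "v (x + y) = v x + v y" and v_scaleC: "v (c *\<^sub>C x) = c *\<^sub>C v x" for x y c
    by (metis u_add uv vu, metis u_scaleC uv vu)
  define S where "S = adjoint_op U \<circ>\<^sub>m A \<circ>\<^sub>m U"
  have S_iff: "S g = Some h \<longleftrightarrow> A (u g) = Some (u h)" for g h
    by (cases "A (u g)") (auto simp: S_def map_comp_def U_eq V_eq uv vu)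
  have "f \<in> dom S \<longleftrightarrow> u f \<in> dom A" for f
    by (cases "A (u f)") (auto simp: S_def map_comp_def U_eq V_eq dom_def)
  then have dom_S: "dom S = {f. u f \<in> dom A}"
    by blast
  have the_S: "the (S f) = v (the (A (u f)))" if "u f \<in> dom A" for f
    using that S_iff[of f "v (the (A (u f)))"] by (auto simp: uv)
  have lin: "linear_operator S"
    unfolding linear_operator_def complex_vector.subspace_def
  proof (intro conjI ballI allI)
    have "u 0 = 0"
      using u_scaleC[of 0 0] by simp
    then show "0 \<in> dom S"
      using L(2) by (simp add: dom_S)
  qed (simp_all add: dom_S u_add u_scaleC the_S L v_add v_scaleC)
  have dense: "closure (dom S) = UNIV"
  proof (rule closure_subspace_eq_UNIV)
    show "subspace (dom S)"
      by (intro csubspace_imp_subspace linear_operatorD(1)[OF lin])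
    fix x assume x: "\<And>y. y \<in> dom S \<Longrightarrow> inner x y = 0"
    have "u x = 0"
    proof (rule orthogonal_to_dense[OF self_adjointD(2)[OF A(1)]])
      show "inner (u x) y = 0" if "y \<in> dom A" for y
        unfolding adj by (rule x) (simp add: dom_S uv that)
    qed
    then show "x = 0"
      using norm_u[of x] by simp
  qed
  have "S g = Some h \<longleftrightarrow> (\<forall>f\<in>dom S. inner (the (S f)) g = inner f h)" for g h
  proof -
    have "S g = Some h \<longleftrightarrow> (\<forall>f\<in>dom A. inner (the (A f)) (u g) = inner f (u h))"
      unfolding S_iff self_adjointD(3)[OF A(1)] ..
    also have "\<dots> \<longleftrightarrow> (\<forall>f\<in>dom S. inner (the (S f)) g = inner f h)"
    proof (intro iffI ballI)
      fix f assume *: "\<forall>f\<in>dom A. inner (the (A f)) (u g) = inner f (u h)" and "f \<in> dom S"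
      then have f: "u f \<in> dom A"
        by (simp add: dom_S)
      show "inner (the (S f)) g = inner f h"
        unfolding the_S[OF f] adj' using *[rule_format, OF f] by (simp add: adj vu)
    next
      fix f assume *: "\<forall>f\<in>dom S. inner (the (S f)) g = inner f h" and f: "f \<in> dom A"
      have "inner (the (S (v f))) g = inner (v f) h"
        using * f by (simp add: dom_S uv)
      then show "inner (the (A f)) (u g) = inner f (u h)"
        using f by (simp add: the_S uv adj')
    qed
    finally show ?thesis .
  qed
  then have "self_adjoint S"
    unfolding self_adjoint_iff using lin dense by blast
  then show "self_adjoint (adjoint_op U \<circ>\<^sub>m A \<circ>\<^sub>m U)"
    by (simp add: S_def)
  have "bounded_operator A" if bounded: "bounded_operator S"
  proof -
    obtain K where K: "\<And>f. f \<in> dom S \<Longrightarrow> norm (the (S f)) \<le> K * norm f"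
      using bounded unfolding bounded_operator_def by blast
    have "norm (the (A f)) \<le> K * norm f" if "f \<in> dom A" for f
      using K[of "v f"] that by (simp add: dom_S the_S uv norm_v)
    then show ?thesis
      unfolding bounded_operator_def by blast
  qed
  then show "\<not> bounded_operator (adjoint_op U \<circ>\<^sub>m A \<circ>\<^sub>m U)"
    using A(2) by (auto simp: S_def)
qed

section \<open>Closed restrictions and closed subspaces\<close>

text \<open>Restrict \<open>A\<close> to the \<open>f\<close> with \<open>A f + \<i> f\<close> in
  \<open>M\<close>; closedness is inherited from \<open>A\<close> and \<open>M\<close>. If moreover
  \<open>A f\<close> is in \<open>dom A\<close>, then \<open>A f + \<i> f\<close> lies in
  \<open>M \<inter> dom A\<close>, so it vanishes and \<open>f = 0\<close>. If \<open>x\<close> is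
  orthogonal to the restricted domain, then \<open>(A - \<i>)^-1 x\<close> is in
  \<open>dom A\<close> and orthogonal to \<open>M\<close>, so it vanishes and
  \<open>x = 0\<close>.\<close>

lemma ex_restriction_of_subspace:
  fixes A :: "'a::complex_hilbert \<rightharpoonup> 'a"
  assumes A: "self_adjoint A" and M: "csubspace M" "closed M"
    and disj: "M \<inter> dom A = {0}" "orthogonal_complement M \<inter> dom A = {0}"
  shows "\<exists>A\<^sub>0. linear_operator A\<^sub>0 \<and> closed_operator A\<^sub>0 \<and> densely_defined A\<^sub>0 \<and>
    A\<^sub>0 \<subseteq>\<^sub>m A \<and> dom (A \<circ>\<^sub>m A\<^sub>0) = {0}"
proof -
  note L = linear_operatorD[OF self_adjointD(1)[OF A]]
  note i = imaginary_unit_skew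
  note M_ops = complex_vector.subspace_0[OF M(1)] complex_vector.subspace_add[OF M(1)]
    complex_vector.subspace_scale[OF M(1)]
  define D where "D = {f \<in> dom A. the (A f) + \<i> *\<^sub>C f \<in> M}"
  define A0 where "A0 = A |` D"
  have A0: "A0 f = Some g \<longleftrightarrow> A f = Some g \<and> g + \<i> *\<^sub>C f \<in> M" for f g
    by (auto simp: A0_def D_def restrict_map_def)
  have dom_A0: "dom A0 = D"
    by (auto simp: A0_def D_def)
  have the_A0: "the (A0 f) = the (A f)" if "f \<in> D" for f
    using that by (simp add: A0_def)
  have A_0: "the (A 0) = 0"
    using L(7)[OF L(2), of 0] by simp
  have sub: "csubspace D"
    unfolding complex_vector.subspace_def
  proof (intro conjI ballI allI)
    show "0 \<in> D"
      using L(2) M_ops(1) A_0 by (simp add: D_def)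
    fix f assume f: "f \<in> D"
    have "c *\<^sub>C (the (A f) + \<i> *\<^sub>C f) \<in> M" for c
      using f by (intro M_ops(3)) (simp add: D_def)
    then have "c *\<^sub>C the (A f) + (\<i> * c) *\<^sub>C f \<in> M" for c
      by (simp add: scaleC_add_right scaleC_scaleC mult.commute[of \<i>])
    then show "c *\<^sub>C f \<in> D" for c
      using f by (simp add: D_def L(5,7) scaleC_scaleC)
    fix g assume g: "g \<in> D"
    have "(the (A f) + \<i> *\<^sub>C f) + (the (A g) + \<i> *\<^sub>C g) \<in> M"
      using f g by (intro M_ops(2)[of "the (A f) + _"]) (simp_all add: D_def)
    then show "f + g \<in> D"
      using f g by (simp add: D_def L(3,6) scaleC_add_right add_ac)
  qed
  have lin: "linear_operator A0"
    unfolding linear_operator_def dom_A0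
  proof (intro conjI ballI allI sub)
    fix f g assume "f \<in> D" "g \<in> D"
    then show "the (A0 (f + g)) = the (A0 f) + the (A0 g)"
      using complex_vector.subspace_add[OF sub] by (simp add: the_A0) (simp add: D_def L(6))
  next
    fix c f assume "f \<in> D"
    then show "the (A0 (c *\<^sub>C f)) = c *\<^sub>C the (A0 f)"
      using complex_vector.subspace_scale[OF sub] by (simp add: the_A0) (simp add: D_def L(7))
  qed
  moreover have "closed_operator A0"
    unfolding closed_operator_def closed_sequential_limits
  proof (intro allI impI)
    fix p l assume p: "(\<forall>n. p n \<in> Map.graph A0) \<and> p \<longlonglongrightarrow> l"
    obtain f g where l: "l = (f, g)"
      by (cases l)
    have graph: "A0 (fst (p n)) = Some (snd (p n))" for n
      using p by (metis in_graphD prod.collapse)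
    have lim: "(\<lambda>n. fst (p n)) \<longlonglongrightarrow> f" "(\<lambda>n. snd (p n)) \<longlonglongrightarrow> g"
      using p tendsto_fst[of p l] tendsto_snd[of p l] by (simp_all add: l)
    have A_p: "A (fst (p n)) = Some (snd (p n))" and M_p: "snd (p n) + \<i> *\<^sub>C fst (p n) \<in> M" for n
      using graph[of n] by (simp_all add: A0)
    have "A f = Some g"
      by (rule self_adjoint_closed[OF A _ lim(1)]) (use A_p lim(2) in auto)
    moreover have "(\<lambda>n. snd (p n) + \<i> *\<^sub>C fst (p n)) \<longlonglongrightarrow> g + \<i> *\<^sub>C f"
      by (intro tendsto_add lim bounded_linear.tendsto[OF bounded_linear_scaleC])
    then have "g + \<i> *\<^sub>C f \<in> M"
      by (rule closed_sequentially[OF M(2) M_p])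
    ultimately show "l \<in> Map.graph A0"
      by (simp add: l A0 in_graphI)
  qed
  moreover have "densely_defined A0"
    unfolding densely_defined_def
  proof (rule closure_subspace_eq_UNIV)
    show "subspace (dom A0)"
      unfolding dom_A0 by (rule csubspace_imp_subspace[OF sub])
    fix x assume x: "\<And>y. y \<in> dom A0 \<Longrightarrow> inner x y = 0"
    define z where "z = resolvent A (- \<i>) x"
    have "z \<in> dom A"
      unfolding z_def by (rule resolvent_in_dom[OF A i(3,4)])
    moreover have "inner z m = 0" if "m \<in> M" for m
    proof -
      have "resolvent A \<i> m \<in> dom A0"
        using that resolvent_in_dom[OF A i(1,2)] shift_resolvent[OF A i(1,2)]
        by (simp add: dom_A0 D_def)
      then have "inner x (resolvent A \<i> m) = 0"
        by (rule x)
      then show ?thesis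
        using inner_resolvent[OF A i(1,2), of m x] by (simp add: z_def inner_commute)
    qed
    ultimately have "z = 0"
      using disj(2) unfolding orthogonal_complement_csubspace[OF M(1)] by blast
    then show "x = 0"
      using shift_resolvent[OF A i(3,4), of x] A_0 unfolding z_def by simp
  qed
  moreover have "A0 \<subseteq>\<^sub>m A"
    by (auto simp: map_le_def A0_def)
  moreover have "dom (A \<circ>\<^sub>m A0) = {0}"
  proof (intro equalityI subsetI)
    fix f assume "f \<in> dom (A \<circ>\<^sub>m A0)"
    then have f: "f \<in> D" "the (A f) \<in> dom A"
      using the_A0 unfolding dom_operator_product dom_A0 by auto
    then have "the (A f) + \<i> *\<^sub>C f \<in> M \<inter> dom A"
      using L(3)[OF f(2) L(5)] by (simp add: D_def)
    then have "the (A f) + \<i> *\<^sub>C f = 0"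
      using disj(1) by blast
    \<comment> \<open>Zero is written as the shift of zero so that injectivity of the shift
      applies.\<close>
    then have "the (A f) + \<i> *\<^sub>C f = the (A 0) + \<i> *\<^sub>C 0"
      by (simp add: A_0)
    then have "f = 0"
      by (rule self_adjoint_shift_inj[OF A i(1,2) _ L(2), rotated]) (use f(1) in \<open>simp add: D_def\<close>)
    then show "f \<in> {0}"
      by simp
  next
    fix f :: 'a assume "f \<in> {0}"
    moreover have "0 \<in> D"
      by (rule complex_vector.subspace_0[OF sub])
    ultimately show "f \<in> dom (A \<circ>\<^sub>m A0)"
      using L(2) by (simp add: dom_operator_product dom_A0 the_A0 A_0)
  qed
  ultimately show ?thesis
    by blast
qed

text \<open>Let \<open>M\<close> be the image of \<open>dom A0\<close> under
  \<open>A + \<i>\<close>. For \<open>y\<close> in \<open>M \<inter> dom A\<close> with preimage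
  \<open>f\<close>, the value \<open>A f = y - \<i> f\<close> is again in \<open>dom A\<close>, so
  \<open>f = 0\<close>. For \<open>x\<close> in \<open>dom A\<close> orthogonal to \<open>M\<close>,
  the vector \<open>(A - \<i>) x\<close> is orthogonal to the dense domain of \<open>A0\<close>, so
  \<open>x = 0\<close>.\<close>

lemma ex_subspace_of_restriction:
  fixes A :: "'a::complex_hilbert \<rightharpoonup> 'a"
  assumes A: "self_adjoint A" and A0: "linear_operator A0" "closed_operator A0" "densely_defined A0"
    "A0 \<subseteq>\<^sub>m A" "dom (A \<circ>\<^sub>m A0) = {0}"
  shows "\<exists>M. csubspace M \<and> closed M \<and> M \<inter> dom A = {0} \<and> orthogonal_complement M \<inter> dom A = {0}"
proof -
  note L = linear_operatorD[OF self_adjointD(1)[OF A]]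
  note L0 = linear_operatorD[OF A0(1)]
  note i = imaginary_unit_skew
  have A_0: "the (A 0) = 0"
    using L(7)[OF L(2), of 0] by simp
  have A0_eq: "A0 f = A f" "f \<in> dom A" if "f \<in> dom A0" for f
    using A0(4) that map_le_implies_dom_le[OF A0(4)] by (auto simp: map_le_def)
  \<comment> \<open>Writing the image as a preimage under the resolvent gives the subspace property
    from linearity of the resolvent.\<close>
  define M where "M = {y. resolvent A \<i> y \<in> dom A0}"
  have M: "the (A f) + \<i> *\<^sub>C f \<in> M" if "f \<in> dom A0" for f
    using that resolvent_eqI[OF A i(1,2) A0_eq(2)[OF that] refl] by (simp add: M_def)
  have sub: "csubspace M"
    unfolding complex_vector.subspace_def
  proof (intro conjI ballI allI)
    show "0 \<in> M"
      using M[OF L0(2)] by (simp add: A_0)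
  qed (simp_all add: M_def resolvent_add[OF A i(1,2)] resolvent_scaleC[OF A i(1,2)] L0(3,5))
  moreover have "closed M"
    unfolding closed_sequential_limits
  proof (intro allI impI)
    fix y l assume y: "(\<forall>n. y n \<in> M) \<and> y \<longlonglongrightarrow> l"
    define f where "f n = resolvent A \<i> (y n)" for n
    have f: "f n \<in> dom A0" for n
      using y by (simp add: f_def M_def)
    have "the (A (f n)) + \<i> *\<^sub>C f n = y n" for n
      unfolding f_def by (rule shift_resolvent[OF A i(1,2)])
    \<comment> \<open>For a convergent sequence \<open>y n\<close> in \<open>M\<close> both
      \<open>f n\<close> and this value converge, so the closed graph of \<open>A0\<close> contains
      the limit pair.\<close>
    then have Af: "the (A0 (f n)) = y n - \<i> *\<^sub>C f n" for n
      unfolding A0_eq(1)[OF f] by (simp add: algebra_simps eq_diff_eq)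
    have lim_f: "f \<longlonglongrightarrow> resolvent A \<i> l"
      unfolding f_def
      using y by (intro bounded_linear.tendsto[OF bounded_linear_resolvent[OF A i(1,2)]]) blast
    then have lim: "(\<lambda>n. (f n, the (A0 (f n)))) \<longlonglongrightarrow> (resolvent A \<i> l, l - \<i> *\<^sub>C resolvent A \<i> l)"
      unfolding Af
      using y by (intro tendsto_Pair tendsto_diff bounded_linear.tendsto[OF bounded_linear_scaleC]) blast+
    have "(f n, the (A0 (f n))) \<in> Map.graph A0" for n
      using f[of n] by (intro in_graphI) auto
    then have "(resolvent A \<i> l, l - \<i> *\<^sub>C resolvent A \<i> l) \<in> Map.graph A0"
      by (rule closed_sequentially[OF A0(2)[unfolded closed_operator_def] _ lim])
    then show "l \<in> M"
      by (auto simp: M_def dest: in_graphD)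
  qed
  moreover have "M \<inter> dom A = {0}"
  proof (intro equalityI subsetI)
    fix y assume y: "y \<in> M \<inter> dom A"
    define f where "f = resolvent A \<i> y"
    have f: "f \<in> dom A0" "the (A f) + \<i> *\<^sub>C f = y"
      using y shift_resolvent[OF A i(1,2), of y] by (simp_all add: f_def M_def)
    have "y - \<i> *\<^sub>C f \<in> dom A"
      using y A0_eq(2)[OF f(1)] by (intro L) simp_all
    moreover have "the (A0 f) = y - \<i> *\<^sub>C f"
      unfolding A0_eq(1)[OF f(1)] by (simp add: f(2)[symmetric])
    ultimately have "f \<in> dom (A \<circ>\<^sub>m A0)"
      using f(1) by (simp add: dom_operator_product)
    then have "f = 0"
      using A0(5) by blast
    then show "y \<in> {0}"
      using f(2) by (simp add: A_0)
  qed (use L(2) complex_vector.subspace_0[OF sub] in simp)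
  moreover have "orthogonal_complement M \<inter> dom A = {0}"
  proof (intro equalityI subsetI)
    fix x assume x: "x \<in> orthogonal_complement M \<inter> dom A"
    have "the (A x) + (- \<i>) *\<^sub>C x = 0"
    proof (rule orthogonal_to_dense[of "dom A0"])
      show "closure (dom A0) = UNIV"
        using A0(3) by (simp add: densely_defined_def)
      fix f assume f: "f \<in> dom A0"
      have "inner x (the (A f) + \<i> *\<^sub>C f) = 0"
        using x M[OF f] unfolding orthogonal_complement_csubspace[OF sub] by blast
      then show "inner (the (A x) + (- \<i>) *\<^sub>C x) f = 0"
        using self_adjoint_symmetric[OF A _ A0_eq(2)[OF f], of x] x
        by (simp only: inner_add_left inner_add_right inner_scaleC_left[of "- \<i>"] i(3)) simp
    qed
    then have "the (A x) + (- \<i>) *\<^sub>C x = the (A 0) + (- \<i>) *\<^sub>C 0"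
      by (simp add: A_0)
    then have "x = 0"
      by (rule self_adjoint_shift_inj[OF A i(3,4) _ L(2), rotated]) (use x in blast)
    then show "x \<in> {0}"
      by simp
  qed (use L(2) in \<open>simp add: orthogonal_complement_csubspace[OF sub]\<close>)
  ultimately show ?thesis
    by blast
qed

section \<open>Equivalence of the six assertions\<close>

theorem theorem5p1:
  fixes A :: "'a::complex_hilbert \<rightharpoonup> 'a"
  assumes infinite_dimensional: "\<not> (\<exists>F :: 'a set. finite F \<and> cspan F = UNIV)"
    and "self_adjoint A" and "\<not> bounded_operator A"
  shows "all_equivalent
     [\<exists>U :: 'a \<rightharpoonup> 'a. unitary_operator U \<and> dom (adjoint_op U \<circ>\<^sub>m A \<circ>\<^sub>m U) \<inter> dom A = {0},
      \<exists>S :: 'a \<rightharpoonup> 'a. self_adjoint S \<and> \<not> bounded_operator S \<and> dom S \<inter> dom A = {0},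
      \<exists>J :: 'a \<rightharpoonup> 'a. fundamental_symmetry J \<and> dom (J \<circ>\<^sub>m A \<circ>\<^sub>m J) \<inter> dom A = {0},
      \<exists>M :: 'a set. csubspace M \<and> closed M \<and>
         M \<inter> dom A = {0} \<and> orthogonal_complement M \<inter> dom A = {0},
      \<exists>B :: 'a \<rightharpoonup> 'a. self_adjoint B \<and> positive_definite B \<and> dom A \<subseteq> dom B \<and>
         closure ((\<lambda>f. the (B f)) ` dom A) \<inter> dom B = {0},
      \<exists>A\<^sub>0 :: 'a \<rightharpoonup> 'a. linear_operator A\<^sub>0 \<and> closed_operator A\<^sub>0 \<and> densely_defined A\<^sub>0 \<and>
         A\<^sub>0 \<subseteq>\<^sub>m A \<and> dom (A \<circ>\<^sub>m A\<^sub>0) = {0}]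
   \<and> (\<forall>A\<^sub>0 :: 'a \<rightharpoonup> 'a. linear_operator A\<^sub>0 \<and> closed_operator A\<^sub>0 \<and> densely_defined A\<^sub>0 \<and>
         A\<^sub>0 \<subseteq>\<^sub>m A \<and> dom (A \<circ>\<^sub>m A\<^sub>0) = {0} \<longrightarrow> dom (A\<^sub>0 \<circ>\<^sub>m A\<^sub>0) = {0})"
proof
  \<comment> \<open>Naming the assertions leaves a propositional problem: a cycle through the first
    five and a two-way link between the fourth and the sixth.\<close>
  define c1 where "c1 \<longleftrightarrow> (\<exists>U :: 'a \<rightharpoonup> 'a. unitary_operator U \<and>
    dom (adjoint_op U \<circ>\<^sub>m A \<circ>\<^sub>m U) \<inter> dom A = {0})"
  define c2 where "c2 \<longleftrightarrow> (\<exists>S :: 'a \<rightharpoonup> 'a. self_adjoint S \<and> \<not> bounded_operator S \<and>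
    dom S \<inter> dom A = {0})"
  define c3 where "c3 \<longleftrightarrow> (\<exists>J :: 'a \<rightharpoonup> 'a. fundamental_symmetry J \<and>
    dom (J \<circ>\<^sub>m A \<circ>\<^sub>m J) \<inter> dom A = {0})"
  define c4 where "c4 \<longleftrightarrow> (\<exists>M :: 'a set. csubspace M \<and> closed M \<and>
    M \<inter> dom A = {0} \<and> orthogonal_complement M \<inter> dom A = {0})"
  define c5 where "c5 \<longleftrightarrow> (\<exists>B :: 'a \<rightharpoonup> 'a. self_adjoint B \<and> positive_definite B \<and> dom A \<subseteq> dom B \<and>
    closure ((\<lambda>f. the (B f)) ` dom A) \<inter> dom B = {0})"
  define c6 where "c6 \<longleftrightarrow> (\<exists>A\<^sub>0 :: 'a \<rightharpoonup> 'a. linear_operator A\<^sub>0 \<and> closed_operator A\<^sub>0 \<and>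
    densely_defined A\<^sub>0 \<and> A\<^sub>0 \<subseteq>\<^sub>m A \<and> dom (A \<circ>\<^sub>m A\<^sub>0) = {0})"
  have "c1 \<longrightarrow> c2"
    unfolding c1_def c2_def using self_adjoint_unitary_conjugate[OF assms(2,3)] by blast
  moreover have "c2 \<longrightarrow> c5"
    unfolding c2_def c5_def
    using ex_positive_definite_of_disjoint_domains[OF assms(2)] by blast
  moreover have "c5 \<longrightarrow> c4"
    unfolding c5_def c4_def using ex_subspace_of_positive_definite[OF assms(2)] by blast
  moreover have "c4 \<longrightarrow> c3"
    unfolding c4_def c3_def using ex_fundamental_symmetry_of_subspace[OF assms(2)] by blast
  moreover have "c3 \<longrightarrow> c1"
    unfolding c3_def c1_def using fundamental_symmetry_imp_unitary by metis
  moreover have "c4 \<longrightarrow> c6"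
    unfolding c4_def c6_def using ex_restriction_of_subspace[OF assms(2)] by blast
  moreover have "c6 \<longrightarrow> c4"
    unfolding c6_def c4_def using ex_subspace_of_restriction[OF assms(2)] by blast
  ultimately have "c1 = c2" "c3 = c2" "c4 = c2" "c5 = c2" "c6 = c2"
    by argo+
  then have "all_equivalent [c1, c2, c3, c4, c5, c6]"
    by (simp add: all_equivalent_def)
  then show "all_equivalent
     [\<exists>U :: 'a \<rightharpoonup> 'a. unitary_operator U \<and> dom (adjoint_op U \<circ>\<^sub>m A \<circ>\<^sub>m U) \<inter> dom A = {0},
      \<exists>S :: 'a \<rightharpoonup> 'a. self_adjoint S \<and> \<not> bounded_operator S \<and> dom S \<inter> dom A = {0},
      \<exists>J :: 'a \<rightharpoonup> 'a. fundamental_symmetry J \<and> dom (J \<circ>\<^sub>m A \<circ>\<^sub>m J) \<inter> dom A = {0},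
      \<exists>M :: 'a set. csubspace M \<and> closed M \<and>
         M \<inter> dom A = {0} \<and> orthogonal_complement M \<inter> dom A = {0},
      \<exists>B :: 'a \<rightharpoonup> 'a. self_adjoint B \<and> positive_definite B \<and> dom A \<subseteq> dom B \<and>
         closure ((\<lambda>f. the (B f)) ` dom A) \<inter> dom B = {0},
      \<exists>A\<^sub>0 :: 'a \<rightharpoonup> 'a. linear_operator A\<^sub>0 \<and> closed_operator A\<^sub>0 \<and> densely_defined A\<^sub>0 \<and>
         A\<^sub>0 \<subseteq>\<^sub>m A \<and> dom (A \<circ>\<^sub>m A\<^sub>0) = {0}]"
    unfolding c1_def c2_def c3_def c4_def c5_def c6_def .
next
  show "\<forall>A\<^sub>0 :: 'a \<rightharpoonup> 'a. linear_operator A\<^sub>0 \<and> closed_operator A\<^sub>0 \<and> densely_defined A\<^sub>0 \<and>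
         A\<^sub>0 \<subseteq>\<^sub>m A \<and> dom (A \<circ>\<^sub>m A\<^sub>0) = {0} \<longrightarrow> dom (A\<^sub>0 \<circ>\<^sub>m A\<^sub>0) = {0}"
  proof (intro allI impI, elim conjE)
    fix A0 :: "'a \<rightharpoonup> 'a"
    assume A0: "linear_operator A0" "A0 \<subseteq>\<^sub>m A" "dom (A \<circ>\<^sub>m A0) = {0}"
    note L = linear_operatorD[OF A0(1)]
    have "the (A0 0) = 0"
      using L(7)[OF L(2), of 0] by simp
    then have "0 \<in> dom (A0 \<circ>\<^sub>m A0)"
      using L(2) by (simp add: dom_operator_product)
    \<comment> \<open>A value of \<open>A0\<close> that lies in \<open>dom A0\<close> also lies in
      the larger \<open>dom A\<close>.\<close>
    moreover have "dom (A0 \<circ>\<^sub>m A0) \<subseteq> dom (A \<circ>\<^sub>m A0)"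
      using map_le_implies_dom_le[OF A0(2)] unfolding dom_operator_product by blast
    ultimately show "dom (A0 \<circ>\<^sub>m A0) = {0}"
      using A0(3) by blast
  qed
qed

end
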